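(* There is a polynomial-time algorithm that solves the Stochastic Boolean Function Evaluation problem for linear threshold formulas with integer coefficients with approximation factor $3$: for every linear threshold formula $\sum_{i=1}^n a_i x_i\ge\theta$ with integers $a_1,\dots,a_n,\theta$, every probability vector $p\in(0,1)^n$ and every cost vector $c\ge0$, the expected testing cost of the algorithm is at most $3$ times the minimum expected testing cost of any strategy that evaluates the function.
   Context: The linear threshold formula $\sum_{i=1}^n a_ix_i\ge\theta$ represents $f:\{0,1\}^n\to\{0,1\}$ with $f(x)=1$ iff $\sum_i a_ix_i\ge\theta$. Stochastic Boolean Function Evaluation (SBFE): input is a representation of $f$, $p=(p_1,\dots,p_n)$ with $0<p_i<1$, and costs $c_i\ge0$. An unknown $x\in\{0,1\}^n$ is drawn from the product distribution with $\Pr[x_i=1]=p_i$; $x_i$ can be learned only by testing $i$ at cost $c_i$. A strategy adaptively tests variables until the observed partial assignment $b\in\{0,1,*\}^n$ is a $0$-certificate or $1$-certificate of $f$ (i.e. $f$ is constant on all $a\in\{0,1\}^n$ agreeing with $b$ on its non-$*$ coordinates), then outputs $f(x)$. Its cost is the expected total testing cost; an optimal strategy minimizes it. The running time is the worst-case time to determine the next variable to test or to compute the output. *)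

theory Defs
  imports "HOL-Probability.Probability" "HOL-Computational_Algebra.Polynomial"
    "HOL-Library.Log_Nat"
begin

section \<open>Stochastic evaluation of linear threshold formulas\<close>

text \<open>
  A point of \<open>{0,1}\<^sup>n\<close> is a function \<open>nat \<Rightarrow> bool\<close> of which only the coordinates \<open>i < n\<close> matter;
  coordinates are numbered from \<open>0\<close>. A partial assignment is a map \<open>nat \<rightharpoonup> bool\<close>
  with domain in \<open>{..<n}\<close>, the value \<open>None\<close> standing for \<open>*\<close>.
\<close>

record ltf_instance =
  dim :: nat
  coef :: "nat \<Rightarrow> int"
  threshold :: int
  prob :: "nat \<Rightarrow> real"
  cost :: "nat \<Rightarrow> real"

definition valid_instance :: "ltf_instance \<Rightarrow> bool" where
  "valid_instance I \<longleftrightarrow> (\<forall>i<dim I. 0 < prob I i \<and> prob I i < 1 \<and> 0 \<le> cost I i)"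

definition rational_instance :: "ltf_instance \<Rightarrow> bool" where
  "rational_instance I \<longleftrightarrow> (\<forall>i<dim I. prob I i \<in> \<rat> \<and> cost I i \<in> \<rat>)"

definition ltf :: "ltf_instance \<Rightarrow> (nat \<Rightarrow> bool) \<Rightarrow> bool" where
  "ltf I x \<longleftrightarrow> (\<Sum>i<dim I. coef I i * of_bool (x i)) \<ge> threshold I"

definition certificate :: "((nat \<Rightarrow> bool) \<Rightarrow> bool) \<Rightarrow> (nat \<rightharpoonup> bool) \<Rightarrow> bool \<Rightarrow> bool" where
  "certificate f b v \<longleftrightarrow> (\<forall>x. (\<forall>i w. b i = Some w \<longrightarrow> x i = w) \<longrightarrow> f x = v)"

text \<open>In \<open>Test i T\<^sub>0 T\<^sub>1\<close> the strategy continues with \<open>T\<^sub>0\<close> if \<open>x\<^sub>i = 0\<close> and with \<open>T\<^sub>1\<close> if \<open>x\<^sub>i = 1\<close>.\<close>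

datatype strategy = Output bool | Test nat strategy strategy

fun evaluates :: "((nat \<Rightarrow> bool) \<Rightarrow> bool) \<Rightarrow> nat \<Rightarrow> (nat \<rightharpoonup> bool) \<Rightarrow> strategy \<Rightarrow> bool" where
  "evaluates f n b (Output v) \<longleftrightarrow> certificate f b v"
| "evaluates f n b (Test i T0 T1) \<longleftrightarrow>
     i < n \<and> b i = None \<and> \<not> certificate f b False \<and> \<not> certificate f b True \<and>
     evaluates f n (b(i \<mapsto> False)) T0 \<and> evaluates f n (b(i \<mapsto> True)) T1"

fun testing_cost :: "(nat \<Rightarrow> real) \<Rightarrow> strategy \<Rightarrow> (nat \<Rightarrow> bool) \<Rightarrow> real" where
  "testing_cost c (Output v) x = 0"
| "testing_cost c (Test i T0 T1) x = c i + testing_cost c (if x i then T1 else T0) x"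

definition expected_cost :: "ltf_instance \<Rightarrow> strategy \<Rightarrow> real" where
  "expected_cost I T =
     measure_pmf.expectation (Pi_pmf {..<dim I} False (\<lambda>i. bernoulli_pmf (prob I i)))
       (testing_cost (cost I) T)"

definition strategies :: "ltf_instance \<Rightarrow> strategy set" where
  "strategies I = {T. evaluates (ltf I) (dim I) Map.empty T}"

definition opt_cost :: "ltf_instance \<Rightarrow> real" where
  "opt_cost I = Min (expected_cost I ` strategies I)"

text \<open>The minimum defining \<^const>\<open>opt_cost\<close> is over a finite nonempty set.\<close>

lemma finite_evaluates: "finite {T. evaluates f n b T}"
proof (induction "card ({..<n} - dom b)" arbitrary: b rule: less_induct)
  case less
  let ?J = "{..<n} - dom b"
  let ?S = "\<lambda>i v. {T. evaluates f n (b(i \<mapsto> v)) T}"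
  have fin: "finite (?S i v)" if "i \<in> ?J" for i v
  proof (rule less)
    have "{..<n} - dom (b(i \<mapsto> v)) \<subset> ?J" using that by auto
    then show "card ({..<n} - dom (b(i \<mapsto> v))) < card ?J"
      by (intro psubset_card_mono) auto
  qed
  have "{T. evaluates f n b T} \<subseteq>
      Output ` UNIV \<union> (\<Union>i\<in>?J. (\<lambda>(T0, T1). Test i T0 T1) ` (?S i False \<times> ?S i True))"
  proof
    fix T assume "T \<in> {T. evaluates f n b T}"
    then show "T \<in> Output ` UNIV \<union> (\<Union>i\<in>?J. (\<lambda>(T0, T1). Test i T0 T1) ` (?S i False \<times> ?S i True))"
    proof (cases T)
      case (Test i T0 T1)
      with \<open>T \<in> _\<close> have "i \<in> ?J" "(T0, T1) \<in> ?S i False \<times> ?S i True"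
        by (auto simp: dom_def)
      moreover have "T = (\<lambda>(T0, T1). Test i T0 T1) (T0, T1)" using Test by simp
      ultimately show ?thesis by blast
    qed blast
  qed
  moreover have "finite (Output ` UNIV \<union>
      (\<Union>i\<in>?J. (\<lambda>(T0, T1). Test i T0 T1) ` (?S i False \<times> ?S i True)))"
    using fin by (intro finite_UnI finite_UN_I finite_imageI finite_cartesian_product) simp_all
  ultimately show ?case by (rule finite_subset)
qed

lemma ex_evaluates:
  assumes "\<And>x y. (\<And>i. i < n \<Longrightarrow> x i = y i) \<Longrightarrow> f x = f y"
  shows "\<exists>T. evaluates f n b T"
proof (induction "card ({..<n} - dom b)" arbitrary: b rule: less_induct)
  case less
  show ?case
  proof (cases "\<exists>v. certificate f b v")
    case True
    then obtain v where "certificate f b v" by blast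
    then have "evaluates f n b (Output v)" by simp
    then show ?thesis by blast
  next
    case False
    have "\<exists>i<n. b i = None"
    proof (rule ccontr)
      assume full: "\<not> (\<exists>i<n. b i = None)"
      have "certificate f b (f (\<lambda>i. the (b i)))"
        unfolding certificate_def
      proof (intro allI impI assms)
        fix x i assume "\<forall>i w. b i = Some w \<longrightarrow> x i = w" "i < n"
        moreover obtain w where "b i = Some w" using full \<open>i < n\<close> by (cases "b i") auto
        ultimately show "x i = the (b i)" by simp
      qed
      with False show False by blast
    qed
    then obtain i where i: "i < n" "b i = None" by blast
    have "\<exists>T. evaluates f n (b(i \<mapsto> v)) T" for v
    proof (rule less)
      have "{..<n} - dom (b(i \<mapsto> v)) \<subset> {..<n} - dom b" using i by auto
      then show "card ({..<n} - dom (b(i \<mapsto> v))) < card ({..<n} - dom b)"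
        by (intro psubset_card_mono) auto
    qed
    then obtain T0 T1 where "evaluates f n (b(i \<mapsto> False)) T0" "evaluates f n (b(i \<mapsto> True)) T1"
      by blast
    with i False have "evaluates f n b (Test i T0 T1)" by simp
    then show ?thesis by blast
  qed
qed

lemma finite_strategies: "finite (strategies I)"
  unfolding strategies_def by (rule finite_evaluates)

lemma strategies_nonempty: "strategies I \<noteq> {}"
proof -
  have "\<exists>T. evaluates (ltf I) (dim I) Map.empty T"
  proof (rule ex_evaluates)
    fix x y :: "nat \<Rightarrow> bool"
    assume "\<And>i. i < dim I \<Longrightarrow> x i = y i"
    then have "(\<Sum>i<dim I. coef I i * of_bool (x i)) = (\<Sum>i<dim I. coef I i * of_bool (y i))"
      by (intro sum.cong) simp_all
    then show "ltf I x = ltf I y" unfolding ltf_def by (rule arg_cong)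
  qed
  then show ?thesis unfolding strategies_def by blast
qed


section \<open>Algorithms\<close>

text \<open>
  A random access machine in structured form. A state holds natural number variables, used for
  counting and addressing, and arrays of numbers. Numeric literals in programs are integers, so
  that a program is a finite object. A number is taken to be a real; starting from rational data,
  a program only ever produces rationals.
\<close>

type_synonym vname = string

record state =
  nvar :: "vname \<Rightarrow> nat"
  arr :: "vname \<Rightarrow> nat \<Rightarrow> real"

datatype iexp = IConst nat | IVar vname | IAdd iexp iexp | ISub iexp iexp

datatype rexp = RConst int | RNat iexp | RArr vname iexp
  | RAdd rexp rexp | RSub rexp rexp | RMul rexp rexp | RDiv rexp rexp

datatype bexp = ILess iexp iexp | RLess rexp rexp | BNot bexp | BAnd bexp bexp

datatype com = Skip | IAssign vname iexp | RAssign vname iexp rexp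
  | Seq com com | Cond bexp com com | While bexp com

fun ival :: "iexp \<Rightarrow> state \<Rightarrow> nat" where
  "ival (IConst k) s = k"
| "ival (IVar x) s = nvar s x"
| "ival (IAdd d e) s = ival d s + ival e s"
| "ival (ISub d e) s = ival d s - ival e s"

fun rval :: "rexp \<Rightarrow> state \<Rightarrow> real" where
  "rval (RConst k) s = of_int k"
| "rval (RNat e) s = real (ival e s)"
| "rval (RArr x e) s = arr s x (ival e s)"
| "rval (RAdd d e) s = rval d s + rval e s"
| "rval (RSub d e) s = rval d s - rval e s"
| "rval (RMul d e) s = rval d s * rval e s"
| "rval (RDiv d e) s = rval d s / rval e s"

fun bval :: "bexp \<Rightarrow> state \<Rightarrow> bool" where
  "bval (ILess d e) s \<longleftrightarrow> ival d s < ival e s"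
| "bval (RLess d e) s \<longleftrightarrow> rval d s < rval e s"
| "bval (BNot d) s \<longleftrightarrow> \<not> bval d s"
| "bval (BAnd d e) s \<longleftrightarrow> bval d s \<and> bval e s"

text \<open>
  Time is charged relative to a weight \<open>w\<close>: every number or address that is read, or computed as
  an intermediate result, contributes its weight. Constant weight \<open>1\<close> counts arithmetic
  operations (the real RAM); the bit length of a reduced fraction gives the logarithmic cost
  criterion, which is polynomially equivalent to Turing machine time.
\<close>

fun icost :: "(real \<Rightarrow> nat) \<Rightarrow> iexp \<Rightarrow> state \<Rightarrow> nat" where
  "icost w (IConst k) s = w (real k)"
| "icost w (IVar x) s = w (real (nvar s x))"
| "icost w (IAdd d e) s = icost w d s + icost w e s + w (real (ival (IAdd d e) s))"
| "icost w (ISub d e) s = icost w d s + icost w e s + w (real (ival (ISub d e) s))"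

fun rcost :: "(real \<Rightarrow> nat) \<Rightarrow> rexp \<Rightarrow> state \<Rightarrow> nat" where
  "rcost w (RConst k) s = w (of_int k)"
| "rcost w (RNat e) s = icost w e s + w (rval (RNat e) s)"
| "rcost w (RArr x e) s = icost w e s + w (rval (RArr x e) s)"
| "rcost w (RAdd d e) s = rcost w d s + rcost w e s + w (rval (RAdd d e) s)"
| "rcost w (RSub d e) s = rcost w d s + rcost w e s + w (rval (RSub d e) s)"
| "rcost w (RMul d e) s = rcost w d s + rcost w e s + w (rval (RMul d e) s)"
| "rcost w (RDiv d e) s = rcost w d s + rcost w e s + w (rval (RDiv d e) s)"

fun bcost :: "(real \<Rightarrow> nat) \<Rightarrow> bexp \<Rightarrow> state \<Rightarrow> nat" where
  "bcost w (ILess d e) s = icost w d s + icost w e s + 1"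
| "bcost w (RLess d e) s = rcost w d s + rcost w e s + 1"
| "bcost w (BNot d) s = bcost w d s + 1"
| "bcost w (BAnd d e) s = bcost w d s + bcost w e s + 1"

text \<open>\<open>exec w P s t s'\<close>: started in \<open>s\<close>, the program \<open>P\<close> halts in \<open>s'\<close> after time \<open>t\<close>.\<close>

inductive exec :: "(real \<Rightarrow> nat) \<Rightarrow> com \<Rightarrow> state \<Rightarrow> nat \<Rightarrow> state \<Rightarrow> bool" for w where
  Skip: "exec w Skip s 1 s"
| IAssign: "exec w (IAssign x e) s (icost w e s + 1)
    (s\<lparr>nvar := (nvar s)(x := ival e s)\<rparr>)"
| RAssign: "exec w (RAssign x d e) s (icost w d s + rcost w e s + 1)
    (s\<lparr>arr := (arr s)(x := (arr s x)(ival d s := rval e s))\<rparr>)"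
| Seq: "exec w P s t s' \<Longrightarrow> exec w Q s' u s'' \<Longrightarrow> exec w (Seq P Q) s (t + u) s''"
| CondTrue: "bval d s \<Longrightarrow> exec w P s t s' \<Longrightarrow> exec w (Cond d P Q) s (bcost w d s + t) s'"
| CondFalse: "\<not> bval d s \<Longrightarrow> exec w Q s t s' \<Longrightarrow> exec w (Cond d P Q) s (bcost w d s + t) s'"
| WhileFalse: "\<not> bval d s \<Longrightarrow> exec w (While d P) s (bcost w d s) s"
| WhileTrue: "bval d s \<Longrightarrow> exec w P s t s' \<Longrightarrow> exec w (While d P) s' u s'' \<Longrightarrow>
    exec w (While d P) s (bcost w d s + t + u) s''"

definition unit_weight :: "real \<Rightarrow> nat" where
  "unit_weight r = 1"

text \<open>Only meaningful for rational arguments.\<close>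

definition bit_weight :: "real \<Rightarrow> nat" where
  "bit_weight r =
     (case quotient_of (inv real_of_rat r) of (k, m) \<Rightarrow> nat (bitlen \<bar>k\<bar>) + nat (bitlen m) + 1)"

text \<open>
  An algorithm for the evaluation problem is a program that is given an instance together with the
  partial assignment \<open>b\<close> observed so far, and determines what to do next. In the array \<open>b\<close> of the
  initial state, \<open>2\<close> stands for \<open>*\<close>. The decision is read off the variable \<open>result\<close>: \<open>0\<close> and \<open>1\<close>
  are outputs, and \<open>i + 2\<close> asks for variable \<open>i\<close> to be tested.
\<close>

definition initial_state :: "ltf_instance \<Rightarrow> (nat \<rightharpoonup> bool) \<Rightarrow> state" where
  "initial_state I b = \<lparr>
     nvar = (\<lambda>_. 0)(''n'' := dim I),
     arr = (\<lambda>_ _. 0)(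
       ''a'' := (\<lambda>i. if i < dim I then of_int (coef I i) else 0),
       ''theta'' := (\<lambda>i. if i = 0 then of_int (threshold I) else 0),
       ''p'' := (\<lambda>i. if i < dim I then prob I i else 0),
       ''c'' := (\<lambda>i. if i < dim I then cost I i else 0),
       ''b'' := (\<lambda>i. if i < dim I then case b i of None \<Rightarrow> 2 | Some v \<Rightarrow> of_bool v else 0))\<rparr>"

definition instance_size :: "(real \<Rightarrow> nat) \<Rightarrow> ltf_instance \<Rightarrow> nat" where
  "instance_size w I = w (of_int (threshold I)) +
     (\<Sum>i<dim I. w (of_int (coef I i)) + w (prob I i) + w (cost I i) + 1)"

definition poly_time :: "(real \<Rightarrow> nat) \<Rightarrow> ltf_instance set \<Rightarrow> com \<Rightarrow> bool" where
  "poly_time w A P \<longleftrightarrow> (\<exists>q :: nat poly. \<forall>I\<in>A. \<forall>b. dom b \<subseteq> {..<dim I} \<longrightarrow>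
     (\<exists>t s. exec w P (initial_state I b) t s \<and> t \<le> poly q (instance_size w I)))"

text \<open>\<open>follows P I b T\<close>: from the observations \<open>b\<close> on, the tests and outputs of \<open>P\<close> are those of \<open>T\<close>.\<close>

inductive follows :: "com \<Rightarrow> ltf_instance \<Rightarrow> (nat \<rightharpoonup> bool) \<Rightarrow> strategy \<Rightarrow> bool" for P I where
  Output: "exec unit_weight P (initial_state I b) t s \<Longrightarrow> nvar s ''result'' = of_bool v \<Longrightarrow>
    follows P I b (Output v)"
| Test: "exec unit_weight P (initial_state I b) t s \<Longrightarrow> nvar s ''result'' = i + 2 \<Longrightarrow>
    follows P I (b(i \<mapsto> False)) T0 \<Longrightarrow> follows P I (b(i \<mapsto> True)) T1 \<Longrightarrow>
    follows P I b (Test i T0 T1)"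

end

theory Submission
  imports Defs
begin

text \<open>
  Let \<open>need I b v\<close> be the amount by which, given the observations \<open>b\<close>, the linear form must still
  move to certify the value \<open>v\<close>. The answer to a test of \<open>i\<close> decreases one of the two needs by
  \<open>\<bar>a\<^sub>i\<bar>\<close>; its gain is that decrease, capped at the need itself, times the other need, both taken at
  \<open>b\<close>. Suppose that the cost of every test is its expected gain. Any strategy that evaluates the
  formula from \<open>b\<close> collects gains of at least \<open>need I b False * need I b True\<close> on every path, and of
  at most \<open>3\<close> times that product, since before its last test neither need is exhausted. For these
  costs every strategy is therefore \<open>3\<close>-approximate.

  Given arbitrary costs, subtract the largest multiple of the expected gains that keeps them
  nonnegative. Some useful variable becomes free; test it and recurse with the reduced costs. By the
  local ratio argument the resulting strategy is \<open>3\<close>-approximate. This is the adaptive dual greedy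
  algorithm. Its reduced costs stay of polynomial bit length, because every round contributes one
  factor of polynomial length to their common denominator.
\<close>

section \<open>Expected costs of decision trees\<close>

fun mean_cost :: "(nat \<Rightarrow> real) \<Rightarrow> (nat \<Rightarrow> real) \<Rightarrow> strategy \<Rightarrow> real" where
  "mean_cost p c (Output v) = 0"
| "mean_cost p c (Test i T0 T1) = c i + (1 - p i) * mean_cost p c T0 + p i * mean_cost p c T1"

lemma mean_cost_add_scaled:
  "mean_cost p (\<lambda>j. c j + y * r j) T = mean_cost p c T + y * mean_cost p r T"
  by (induction T) (auto simp: algebra_simps)

lemma mean_cost_uminus: "mean_cost p (\<lambda>j. - c j) T = - mean_cost p c T"
  by (induction T) (auto simp: algebra_simps)

lemma mean_cost_nonneg:
  assumes "p \<in> {..<n} \<rightarrow> {0..1}" "c \<in> {..<n} \<rightarrow> {0..}" "evaluates f n b T"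
  shows "0 \<le> mean_cost p c T"
  using assms(3)
proof (induction T arbitrary: b)
  case (Test i T0 T1)
  then have "0 \<le> c i" "0 \<le> p i" "p i \<le> 1" "0 \<le> mean_cost p c T0" "0 \<le> mean_cost p c T1"
    using assms(1,2) by auto
  then show ?case by simp
qed simp

lemma testing_cost_fun_upd:
  "evaluates f n b T \<Longrightarrow> b i \<noteq> None \<Longrightarrow> testing_cost c T (x(i := v)) = testing_cost c T x"
  by (induction T arbitrary: b) fastforce+

lemma mean_cost_fun_upd:
  "evaluates f n b T \<Longrightarrow> b i \<noteq> None \<Longrightarrow> mean_cost (p(i := q)) c T = mean_cost p c T"
  by (induction T arbitrary: b) fastforce+

lemma expectation_Pi_pmf_remove:
  fixes h :: "('a \<Rightarrow> 'b) \<Rightarrow> real"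
  assumes "finite A" "i \<in> A" "\<And>j. j \<in> A \<Longrightarrow> finite (set_pmf (q j))"
  shows "measure_pmf.expectation (Pi_pmf A d q) h =
    measure_pmf.expectation (q i)
      (\<lambda>y. measure_pmf.expectation (Pi_pmf (A - {i}) d q) (\<lambda>x. h (x(i := y))))"
proof -
  have "Pi_pmf A d q = bind_pmf (q i) (\<lambda>y. map_pmf (\<lambda>x. x(i := y)) (Pi_pmf (A - {i}) d q))"
    using assms(1,2) Pi_pmf_insert'[of "A - {i}" i d q] by (simp add: insert_absorb map_pmf_def)
  moreover have "finite (set_pmf (Pi_pmf (A - {i}) d q))"
    using assms by (auto simp: set_Pi_pmf)
  ultimately show ?thesis
    using assms
    by (simp add: pmf_expectation_bind[of "set_pmf (q i)"] integral_measure_pmf[of "set_pmf (q i)"])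
qed

lemma expectation_testing_cost:
  assumes "p \<in> {..<n} \<rightarrow> {0..1}" "evaluates f n b T"
  shows "measure_pmf.expectation (Pi_pmf ({..<n} - dom b) False (\<lambda>i. bernoulli_pmf (p i)))
    (testing_cost c T) = mean_cost p c T"
  using assms(2)
proof (induction T arbitrary: b)
  case (Output v)
  have "testing_cost c (Output v) = (\<lambda>_. 0)" by (simp add: fun_eq_iff)
  then show ?case by simp
next
  case (Test i T0 T1)
  let ?P = "\<lambda>A. Pi_pmf A False (\<lambda>i. bernoulli_pmf (p i))"
  let ?A = "{..<n} - dom b"
  have i: "i \<in> ?A" "0 \<le> p i" "p i \<le> 1" using Test.prems assms(1) by auto
  have T: "evaluates f n (b(i \<mapsto> v)) (if v then T1 else T0)" for v using Test.prems by simp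
  have rest: "?A - {i} = {..<n} - dom (b(i \<mapsto> v))" for v by auto
  have "integrable (?P (?A - {i})) (testing_cost c S)" for S
    by (intro integrable_measure_pmf_finite) (auto simp: set_Pi_pmf)
  moreover have "testing_cost c (if v then T1 else T0) (x(i := v)) =
      testing_cost c (if v then T1 else T0) x" for x v
    by (rule testing_cost_fun_upd[OF T]) simp
  ultimately have "measure_pmf.expectation (?P (?A - {i}))
        (\<lambda>x. testing_cost c (Test i T0 T1) (x(i := v))) =
      c i + measure_pmf.expectation (?P (?A - {i})) (testing_cost c (if v then T1 else T0))" for v
    by simp
  also have "\<dots> v = c i + mean_cost p c (if v then T1 else T0)" for v
    using Test.IH T[of v] unfolding rest[of v]
    by (cases v) (simp_all del: dom_fun_upd fun_upd_apply)
  finally show ?case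
    using i by (simp add: expectation_Pi_pmf_remove[of ?A i] algebra_simps)
qed

lemma expected_cost_eq_mean_cost:
  assumes "valid_instance I" "T \<in> strategies I"
  shows "expected_cost I T = mean_cost (prob I) (cost I) T"
  using assms expectation_testing_cost[of "prob I" "dim I" "ltf I" Map.empty T "cost I"]
  by (auto simp: expected_cost_def valid_instance_def strategies_def less_imp_le)

lemma mean_cost_condition:
  assumes "evaluates f n b T"
  shows "mean_cost p c T = (1 - p i) * mean_cost (p(i := 0)) c T + p i * mean_cost (p(i := 1)) c T"
    (is "_ = ?M T")
  using assms
proof (induction T arbitrary: b)
  case (Test j T0 T1)
  show "mean_cost p c (Test j T0 T1) = ?M (Test j T0 T1)"
  proof (cases "j = i")
    case True
    then have "mean_cost (p(i := q)) c T0 = mean_cost p c T0"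
      "mean_cost (p(i := q)) c T1 = mean_cost p c T1" for q
      using Test.prems mean_cost_fun_upd[of f n "b(i \<mapsto> _)" _ i p q c] by auto
    then show ?thesis using True by (simp add: fun_upd_same algebra_simps del: fun_upd_apply)
  next
    case False
    have T: "evaluates f n (b(j \<mapsto> False)) T0" "evaluates f n (b(j \<mapsto> True)) T1"
      using Test.prems by simp_all
    have "mean_cost p c T0 = ?M T0" "mean_cost p c T1 = ?M T1"
      by (rule Test.IH(1)[OF T(1)], rule Test.IH(2)[OF T(2)])
    then have "mean_cost p c (Test j T0 T1) = c j + (1 - p j) * ?M T0 + p j * ?M T1" by simp
    also have "\<dots> = ?M (Test j T0 T1)"
      using False by (simp add: fun_upd_other algebra_simps del: fun_upd_apply)
    finally show ?thesis .
  qed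
qed simp

definition undetermined :: "((nat \<Rightarrow> bool) \<Rightarrow> bool) \<Rightarrow> (nat \<rightharpoonup> bool) \<Rightarrow> bool" where
  "undetermined f b \<longleftrightarrow> (\<forall>v. \<not> certificate f b v)"

lemma certificate_mono: "certificate f b v \<Longrightarrow> b \<subseteq>\<^sub>m b' \<Longrightarrow> certificate f b' v"
  unfolding certificate_def map_le_def by (metis domI)

lemma evaluates_Test_iff:
  "evaluates f n b (Test i T0 T1) \<longleftrightarrow> undetermined f b \<and> i < n \<and> b i = None \<and>
     (\<forall>v. evaluates f n (b(i \<mapsto> v)) (if v then T1 else T0))"
  by (auto simp: undetermined_def all_bool_eq)

lemma evaluates_restrict:
  assumes "p \<in> {..<n} \<rightarrow> {0..1}" "c \<in> {..<n} \<rightarrow> {0..}" "evaluates f n b T" "b k = None"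
  shows "\<exists>T'. evaluates f n (b(k \<mapsto> v)) T' \<and> mean_cost p c T' \<le> mean_cost (p(k := of_bool v)) c T"
    (is "\<exists>T'. ?R b T T'")
  using assms(3,4)
proof (induction T arbitrary: b)
  case (Output u)
  then have "certificate f (b(k \<mapsto> v)) u" by (auto elim!: certificate_mono simp: map_le_def)
  then have "?R b (Output u) (Output u)" by (simp del: fun_upd_apply)
  then show ?case by blast
next
  case (Test i T0 T1)
  have i: "i < n" "b i = None" "0 \<le> c i" "0 \<le> p i" "p i \<le> 1" using Test.prems assms(1,2) by auto
  have T: "evaluates f n (b(i \<mapsto> False)) T0" "evaluates f n (b(i \<mapsto> True)) T1"
    using Test.prems by simp_all
  consider (determined) u where "certificate f (b(k \<mapsto> v)) u"
    | (same) "i = k" | (other) "undetermined f (b(k \<mapsto> v))" "i \<noteq> k"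
    by (auto simp: undetermined_def)
  then have "\<exists>T'. ?R b (Test i T0 T1) T'"
  proof cases
    case determined
    have "p(k := of_bool v) \<in> {..<n} \<rightarrow> {0..1}" using assms(1) by auto
    from mean_cost_nonneg[OF this assms(2) Test.prems(1)]
    have "?R b (Test i T0 T1) (Output u)"
      using determined by (simp del: fun_upd_apply mean_cost.simps(2))
    then show ?thesis by blast
  next
    case same
    then have "evaluates f n (b(k \<mapsto> v)) (if v then T1 else T0)" using T by simp
    moreover from mean_cost_fun_upd[OF this, of k p "of_bool v" c]
    have "mean_cost p c (if v then T1 else T0) \<le> mean_cost (p(k := of_bool v)) c (Test i T0 T1)"
      using same i(3) by (cases v) (simp_all add: fun_upd_same del: fun_upd_apply)
    ultimately show ?thesis by blast
  next
    case other
    then have "(b(i \<mapsto> w)) k = None" for w using Test.prems(2) by simp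
    then obtain T0' T1' where T':
      "evaluates f n (b(i \<mapsto> False, k \<mapsto> v)) T0'"
      "evaluates f n (b(i \<mapsto> True, k \<mapsto> v)) T1'"
      "mean_cost p c T0' \<le> mean_cost (p(k := of_bool v)) c T0"
      "mean_cost p c T1' \<le> mean_cost (p(k := of_bool v)) c T1"
      using Test.IH T by metis
    have "evaluates f n (b(k \<mapsto> v)) (Test i T0' T1')"
      using T'(1,2) other i by (auto simp: undetermined_def fun_upd_twist)
    moreover have "mean_cost p c (Test i T0' T1') \<le> mean_cost (p(k := of_bool v)) c (Test i T0 T1)"
      using T'(3,4) i other(2) by (auto intro!: add_mono mult_left_mono)
    ultimately show ?thesis by blast
  qed
  then show ?case .
qed

definition expected_gain :: "(nat \<Rightarrow> real) \<Rightarrow> (nat \<Rightarrow> bool \<Rightarrow> real) \<Rightarrow> nat \<Rightarrow> real" where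
  "expected_gain p h i = (1 - p i) * h i False + p i * h i True"

lemma mean_cost_ge_potential:
  assumes "p \<in> {..<n} \<rightarrow> {0..1}" "evaluates f n b T"
    and "\<And>b' v. b \<subseteq>\<^sub>m b' \<Longrightarrow> certificate f b' v \<Longrightarrow> Q \<le> \<Phi> b'"
    and "\<And>b' i v. b \<subseteq>\<^sub>m b' \<Longrightarrow> undetermined f b' \<Longrightarrow> i < n \<Longrightarrow> b' i = None \<Longrightarrow>
      \<Phi> (b'(i \<mapsto> v)) \<le> \<Phi> b' + h i v"
  shows "Q \<le> \<Phi> b + mean_cost p (expected_gain p h) T"
  using assms(2-)
proof (induction T arbitrary: b)
  case (Output v)
  then show ?case by simp
next
  case (Test i T0 T1)
  let ?E = "mean_cost p (expected_gain p h)" and ?T = "\<lambda>v. if v then T1 else T0"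
  have i: "undetermined f b" "i < n" "b i = None" "0 \<le> p i" "p i \<le> 1"
    using Test.prems(1) assms(1)
    by (auto simp only: evaluates_Test_iff Pi_iff lessThan_iff atLeastAtMost_iff)
  have branch: "Q \<le> \<Phi> b + h i v + ?E (?T v)" for v
  proof -
    have "b \<subseteq>\<^sub>m b(i \<mapsto> v)" using i by (auto simp: map_le_def)
    then have "Q \<le> \<Phi> (b(i \<mapsto> v)) + ?E (?T v)"
      using Test.IH[of "b(i \<mapsto> v)"] Test.prems map_le_trans[of b "b(i \<mapsto> v)"]
      by (cases v) (simp_all del: fun_upd_apply)
    also have "\<dots> \<le> \<Phi> b + h i v + ?E (?T v)"
      using Test.prems(3)[OF map_le_refl i(1-3), of v] by (rule add_right_mono)
    finally show ?thesis .
  qed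
  have "Q = (1 - p i) * Q + p i * Q" by (simp add: algebra_simps)
  also have "\<dots> \<le> (1 - p i) * (\<Phi> b + h i False + ?E T0) + p i * (\<Phi> b + h i True + ?E T1)"
    using branch[of False] branch[of True] i by (intro add_mono mult_left_mono) auto
  also have "\<dots> = \<Phi> b + ?E (Test i T0 T1)" by (simp add: expected_gain_def algebra_simps)
  finally show ?case .
qed

lemma mean_cost_le_potential:
  assumes "p \<in> {..<n} \<rightarrow> {0..1}" "evaluates f n b T"
    and "\<And>b' v. b \<subseteq>\<^sub>m b' \<Longrightarrow> certificate f b' v \<Longrightarrow> \<Phi> b' \<le> Q"
    and "\<And>b' i v. b \<subseteq>\<^sub>m b' \<Longrightarrow> undetermined f b' \<Longrightarrow> i < n \<Longrightarrow> b' i = None \<Longrightarrow>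
      \<Phi> b' + h i v \<le> \<Phi> (b'(i \<mapsto> v))"
  shows "\<Phi> b + mean_cost p (expected_gain p h) T \<le> Q"
proof -
  have "- Q \<le> - \<Phi> b + mean_cost p (expected_gain p (\<lambda>i v. - h i v)) T"
  proof (rule mean_cost_ge_potential[OF assms(1,2)])
    fix b' i v assume "b \<subseteq>\<^sub>m b'" "undetermined f b'" "i < n" "b' i = None"
    from assms(4)[OF this, of v] show "- \<Phi> (b'(i \<mapsto> v)) \<le> - \<Phi> b' + - h i v" by simp
  qed (use assms(3) in simp)
  also have "expected_gain p (\<lambda>i v. - h i v) = (\<lambda>i. - expected_gain p h i)"
    by (simp add: expected_gain_def fun_eq_iff)
  finally show ?thesis by (simp add: mean_cost_uminus)
qed

section \<open>Local ratio\<close>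

fun argmin_scan :: "(nat \<Rightarrow> bool) \<Rightarrow> (nat \<Rightarrow> 'a::linorder) \<Rightarrow> nat \<Rightarrow> nat" where
  "argmin_scan P u 0 = 0"
| "argmin_scan P u (Suc j) =
     (let k = argmin_scan P u j in if P j \<and> (\<not> P k \<or> u j < u k) then j else k)"

lemma argmin_scan_le: "argmin_scan P u n \<le> n - 1"
  by (induction n) (auto simp: Let_def)

lemma argmin_scan_minimal:
  "i < n \<Longrightarrow> P i \<Longrightarrow> P (argmin_scan P u n) \<and> u (argmin_scan P u n) \<le> u i"
  by (induction n) (auto simp: Let_def less_Suc_eq)

definition cheapest :: "nat \<Rightarrow> (nat \<Rightarrow> real) \<Rightarrow> (nat \<Rightarrow> real) \<Rightarrow> nat" where
  "cheapest n g d = argmin_scan (\<lambda>j. 0 < g j) (\<lambda>j. d j / g j) n"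

definition reduced_cost :: "nat \<Rightarrow> (nat \<Rightarrow> real) \<Rightarrow> (nat \<Rightarrow> real) \<Rightarrow> nat \<Rightarrow> real" where
  "reduced_cost n g d j = d j - d (cheapest n g d) / g (cheapest n g d) * g j"

inductive greedy :: "((nat \<Rightarrow> bool) \<Rightarrow> bool) \<Rightarrow> nat \<Rightarrow> ((nat \<rightharpoonup> bool) \<Rightarrow> nat \<Rightarrow> real) \<Rightarrow>
    (nat \<rightharpoonup> bool) \<Rightarrow> (nat \<Rightarrow> real) \<Rightarrow> strategy \<Rightarrow> bool" for f n g where
  Output: "certificate f b v \<Longrightarrow> greedy f n g b d (Output v)"
| Test: "undetermined f b \<Longrightarrow> k = cheapest n (g b) d \<Longrightarrow>
    greedy f n g (b(k \<mapsto> False)) (reduced_cost n (g b) d) T0 \<Longrightarrow>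
    greedy f n g (b(k \<mapsto> True)) (reduced_cost n (g b) d) T1 \<Longrightarrow>
    greedy f n g b d (Test k T0 T1)"

locale local_ratio =
  fixes f :: "(nat \<Rightarrow> bool) \<Rightarrow> bool" and n :: nat and p :: "nat \<Rightarrow> real"
    and g :: "(nat \<rightharpoonup> bool) \<Rightarrow> nat \<Rightarrow> real" and \<alpha> :: real
  assumes prob_unit: "p \<in> {..<n} \<rightarrow> {0..1}"
    and factor_nonneg: "0 \<le> \<alpha>"
    and charge_nonneg: "undetermined f b \<Longrightarrow> g b \<in> {..<n} \<rightarrow> {0..}"
    and ex_charge_pos: "undetermined f b \<Longrightarrow> \<exists>j<n. 0 < g b j"
    and charge_pos_imp_None: "undetermined f b \<Longrightarrow> j < n \<Longrightarrow> 0 < g b j \<Longrightarrow> b j = None"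
    and charge_approx: "undetermined f b \<Longrightarrow> evaluates f n b T \<Longrightarrow> evaluates f n b T' \<Longrightarrow>
      mean_cost p (g b) T \<le> \<alpha> * mean_cost p (g b) T'"
begin

lemma
  assumes "undetermined f b"
  shows cheapest_less: "cheapest n (g b) d < n"
    and cheapest_charge_pos: "0 < g b (cheapest n (g b) d)"
    and cheapest_minimal: "\<And>j. j < n \<Longrightarrow> 0 < g b j \<Longrightarrow>
      d (cheapest n (g b) d) / g b (cheapest n (g b) d) \<le> d j / g b j"
proof -
  note least = argmin_scan_minimal[where P = "\<lambda>j. 0 < g b j" and u = "\<lambda>j. d j / g b j" and n = n,
      folded cheapest_def]
  obtain j where j: "j < n" "0 < g b j" using ex_charge_pos[OF assms] by blast
  show "cheapest n (g b) d < n"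
    using argmin_scan_le[of "\<lambda>j. 0 < g b j" "\<lambda>j. d j / g b j" n] j(1) by (simp add: cheapest_def)
  show "0 < g b (cheapest n (g b) d)" using least[OF j] ..
  show "d (cheapest n (g b) d) / g b (cheapest n (g b) d) \<le> d j / g b j"
    if "j < n" "0 < g b j" for j
    using least[OF that] ..
qed

lemma cheapest_None: "undetermined f b \<Longrightarrow> b (cheapest n (g b) d) = None"
  by (intro charge_pos_imp_None cheapest_less cheapest_charge_pos)

lemma
  assumes "undetermined f b" "d \<in> {..<n} \<rightarrow> {0..}" "j < n"
  shows reduced_cost_nonneg: "0 \<le> reduced_cost n (g b) d j"
    and reduced_cost_le: "reduced_cost n (g b) d j \<le> d j"
proof -
  let ?k = "cheapest n (g b) d"
  have "0 \<le> d j" "0 \<le> g b j" "0 \<le> d ?k"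
    using assms charge_nonneg[OF assms(1)] cheapest_less[OF assms(1)] by auto
  then show "reduced_cost n (g b) d j \<le> d j"
    using cheapest_charge_pos[OF assms(1), of d] by (simp add: reduced_cost_def)
  show "0 \<le> reduced_cost n (g b) d j"
  proof (cases "0 < g b j")
    case True
    then show ?thesis
      using cheapest_minimal[OF assms(1,3)] by (simp add: reduced_cost_def pos_le_divide_eq)
  next
    case False
    then show ?thesis using \<open>0 \<le> d j\<close> \<open>0 \<le> g b j\<close> by (simp add: reduced_cost_def)
  qed
qed

lemma card_unobserved_cheapest_less:
  assumes "undetermined f b"
  shows "card ({..<n} - dom (b(cheapest n (g b) d \<mapsto> v))) < card ({..<n} - dom b)"
  using cheapest_less[OF assms] cheapest_None[OF assms] by (intro psubset_card_mono) auto

lemma ex_greedy: "\<exists>T. greedy f n g b d T"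
proof (induction "card ({..<n} - dom b)" arbitrary: b d rule: less_induct)
  case less
  show ?case
  proof (cases "undetermined f b")
    case True
    then show ?thesis
      using less[OF card_unobserved_cheapest_less[OF True]] by (meson greedy.Test[OF True refl])
  qed (auto simp: undetermined_def intro: greedy.Output)
qed

lemma greedy_evaluates: "greedy f n g b d T \<Longrightarrow> evaluates f n b T"
  by (induction rule: greedy.induct)
    (auto simp: undetermined_def cheapest_less cheapest_None fun_upd_def)

lemma greedy_approx:
  assumes "greedy f n g b d T" "d \<in> {..<n} \<rightarrow> {0..}" "evaluates f n b T'"
  shows "mean_cost p d T \<le> \<alpha> * mean_cost p d T'"
  using assms
proof (induction arbitrary: T')
  case (Output b v d)
  then obtain u where "T' = Output u" by (cases T'; cases v) auto
  then show ?case by simp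
next
  case (Test b k d T0 T1)
  let ?d = "reduced_cost n (g b) d" and ?y = "d k / g b k"
  have k: "k < n" "0 < g b k" "b k = None"
    using Test.hyps(1,2) by (auto simp: cheapest_less cheapest_charge_pos cheapest_None)
  have bounds: "0 \<le> p k" "p k \<le> 1" "0 \<le> d k" using k(1) prob_unit Test.prems(1) by auto
  have d': "?d \<in> {..<n} \<rightarrow> {0..}" using reduced_cost_nonneg[OF Test.hyps(1) Test.prems(1)] by auto
  have split: "mean_cost p d S = mean_cost p ?d S + ?y * mean_cost p (g b) S" for S
    unfolding mean_cost_add_scaled[symmetric] by (simp add: reduced_cost_def Test.hyps(2))
  have "?d k = 0" using k by (simp add: reduced_cost_def Test.hyps(2)[symmetric])
  obtain S0 S1 where S: "evaluates f n (b(k \<mapsto> False)) S0" "evaluates f n (b(k \<mapsto> True)) S1"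
    "mean_cost p ?d S0 \<le> mean_cost (p(k := 0)) ?d T'"
    "mean_cost p ?d S1 \<le> mean_cost (p(k := 1)) ?d T'"
    using evaluates_restrict[OF prob_unit d' Test.prems(2) k(3)] by (metis of_bool_eq(1,2))
  have "mean_cost p ?d (Test k T0 T1) = (1 - p k) * mean_cost p ?d T0 + p k * mean_cost p ?d T1"
    using \<open>?d k = 0\<close> by simp
  also have "\<dots> \<le> (1 - p k) * (\<alpha> * mean_cost p ?d S0) + p k * (\<alpha> * mean_cost p ?d S1)"
    using Test.IH(1)[OF d' S(1)] Test.IH(2)[OF d' S(2)] bounds
    by (intro add_mono mult_left_mono) auto
  also have "\<dots> \<le> (1 - p k) * (\<alpha> * mean_cost (p(k := 0)) ?d T') +
      p k * (\<alpha> * mean_cost (p(k := 1)) ?d T')"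
    using S(3,4) bounds factor_nonneg by (intro add_mono mult_left_mono) auto
  also have "\<dots> = \<alpha> * mean_cost p ?d T'"
    unfolding mean_cost_condition[OF Test.prems(2), of p ?d k] by (simp add: algebra_simps)
  finally have reduced: "mean_cost p ?d (Test k T0 T1) \<le> \<alpha> * mean_cost p ?d T'" .
  have "evaluates f n b (Test k T0 T1)"
    using Test.hyps by (intro greedy_evaluates[of b d] greedy.Test)
  then have "?y * mean_cost p (g b) (Test k T0 T1) \<le> ?y * (\<alpha> * mean_cost p (g b) T')"
    using bounds k by (intro mult_left_mono charge_approx[OF Test.hyps(1) _ Test.prems(2)]) simp_all
  with reduced show ?case by (simp only: split distrib_left mult.left_commute add_mono)
qed

end

section \<open>Threshold formulas\<close>

definition orient :: "bool \<Rightarrow> int \<Rightarrow> int" where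
  "orient v z = (if v then z else - z)"

text \<open>
  The value \<open>0\<close> is treated as the value \<open>1\<close> of the complementary formula: \<open>f x = 0\<close> iff the
  negated linear form is at least \<open>1 - \<theta>\<close>.
\<close>

definition oriented_threshold :: "ltf_instance \<Rightarrow> bool \<Rightarrow> int" where
  "oriented_threshold I v = (if v then threshold I else 1 - threshold I)"

definition least_term :: "ltf_instance \<Rightarrow> (nat \<rightharpoonup> bool) \<Rightarrow> bool \<Rightarrow> nat \<Rightarrow> int" where
  "least_term I b v i = (case b i of
     None \<Rightarrow> min (orient v (coef I i)) 0 | Some w \<Rightarrow> orient v (coef I i) * of_bool w)"

definition need :: "ltf_instance \<Rightarrow> (nat \<rightharpoonup> bool) \<Rightarrow> bool \<Rightarrow> int" where
  "need I b v = oriented_threshold I v - (\<Sum>i<dim I. least_term I b v i)"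

definition favours :: "ltf_instance \<Rightarrow> nat \<Rightarrow> bool \<Rightarrow> bool" where
  "favours I i w \<longleftrightarrow> (w \<longleftrightarrow> 0 < coef I i)"

definition free_coef :: "ltf_instance \<Rightarrow> (nat \<rightharpoonup> bool) \<Rightarrow> nat \<Rightarrow> int" where
  "free_coef I b i = (if b i = None then coef I i else 0)"

lemma ltf_eq_iff:
  "ltf I x = v \<longleftrightarrow> oriented_threshold I v \<le> (\<Sum>i<dim I. orient v (coef I i) * of_bool (x i))"
  by (auto simp: ltf_def oriented_threshold_def orient_def sum_negf)

lemma need_le_0_iff: "need I b v \<le> 0 \<longleftrightarrow> certificate (ltf I) b v"
proof
  assume "need I b v \<le> 0"
  then have "oriented_threshold I v \<le> (\<Sum>i<dim I. orient v (coef I i) * of_bool (x i))"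
    if "\<forall>i w. b i = Some w \<longrightarrow> x i = w" for x
    unfolding need_def diff_le_0_iff_le
    by (rule order_trans, intro sum_mono)
      (use that in \<open>auto simp: least_term_def split: option.split\<close>)
  then show "certificate (ltf I) b v" unfolding certificate_def ltf_eq_iff by blast
next
  assume certificate: "certificate (ltf I) b v"
  define x where "x i = (case b i of None \<Rightarrow> orient v (coef I i) < 0 | Some w \<Rightarrow> w)" for i
  have "ltf I x = v" using certificate by (auto simp: certificate_def x_def)
  moreover have "(\<Sum>i<dim I. least_term I b v i) = (\<Sum>i<dim I. orient v (coef I i) * of_bool (x i))"
    by (intro sum.cong) (auto simp: least_term_def x_def split: option.split)
  ultimately show "need I b v \<le> 0" by (simp add: ltf_eq_iff need_def)
qed

lemma undetermined_ltf_iff: "undetermined (ltf I) b \<longleftrightarrow> (\<forall>v. 0 < need I b v)"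
  by (simp add: undetermined_def need_le_0_iff[symmetric] not_le)

lemma need_upd:
  assumes "i < dim I" "b i = None"
  shows "need I (b(i \<mapsto> w)) v = need I b v - (if favours I i w = v then \<bar>coef I i\<bar> else 0)"
  using assms unfolding need_def
  by (cases v) (auto simp: sum.remove[of _ i] least_term_def orient_def favours_def)

lemma need_antimono:
  assumes "b \<subseteq>\<^sub>m b'"
  shows "need I b' v \<le> need I b v"
  unfolding need_def
proof (intro diff_left_mono sum_mono)
  fix i
  have "b i = None \<or> b' i = b i" using assms by (auto simp: map_le_def dom_def)
  then show "least_term I b v i \<le> least_term I b' v i"
    by (auto simp: least_term_def split: option.split)
qed

lemma sum_need: "need I b False + need I b True = 1 + (\<Sum>i<dim I. \<bar>free_coef I b i\<bar>)"
  unfolding need_def oriented_threshold_def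
  by (simp add: sum.distrib[symmetric] algebra_simps)
    (auto intro!: sum.neutral simp: least_term_def free_coef_def orient_def split: option.split)

definition gain :: "ltf_instance \<Rightarrow> (nat \<rightharpoonup> bool) \<Rightarrow> nat \<Rightarrow> bool \<Rightarrow> int" where
  "gain I b i w = (let v = favours I i w in min \<bar>free_coef I b i\<bar> (need I b v) * need I b (\<not> v))"

abbreviation egain :: "ltf_instance \<Rightarrow> (nat \<rightharpoonup> bool) \<Rightarrow> nat \<Rightarrow> real" where
  "egain I b \<equiv> expected_gain (prob I) (\<lambda>i w. real_of_int (gain I b i w))"

lemma
  assumes "undetermined (ltf I) b"
  shows gain_nonneg: "0 \<le> gain I b i w"
    and gain_le: "gain I b i w \<le> need I b False * need I b True"
    and gain_eq_0_iff: "gain I b i w = 0 \<longleftrightarrow> free_coef I b i = 0"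
proof -
  have need: "0 < need I b v" for v using assms by (simp add: undetermined_ltf_iff)
  let ?v = "favours I i w"
  show "0 \<le> gain I b i w" using need[THEN less_imp_le] by (simp add: gain_def Let_def)
  have "gain I b i w \<le> need I b ?v * need I b (\<not> ?v)"
    unfolding gain_def Let_def using need[THEN less_imp_le] by (intro mult_right_mono) simp_all
  then show "gain I b i w \<le> need I b False * need I b True"
    by (cases ?v) (simp_all add: mult.commute)
  show "gain I b i w = 0 \<longleftrightarrow> free_coef I b i = 0"
    using need[of ?v] need[of "\<not> ?v"] by (auto simp: gain_def Let_def min_def)
qed

lemma prob_in_unit: "valid_instance I \<Longrightarrow> prob I \<in> {..<dim I} \<rightarrow> {0..1}"
  by (auto simp: valid_instance_def intro: less_imp_le)

definition weigh :: "ltf_instance \<Rightarrow> (nat \<rightharpoonup> bool) \<Rightarrow> (bool \<Rightarrow> int) \<Rightarrow> int" where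
  "weigh I b x = x False * need I b True + x True * need I b False"

lemma weigh_eq: "weigh I b x = x v * need I b (\<not> v) + x (\<not> v) * need I b v"
  by (cases v) (simp_all add: weigh_def)

lemma weigh_mono: "undetermined (ltf I) b \<Longrightarrow> (\<And>v. x v \<le> y v) \<Longrightarrow> weigh I b x \<le> weigh I b y"
  unfolding weigh_def
  by (intro add_mono mult_right_mono) (simp_all add: undetermined_ltf_iff less_imp_le)

lemma weigh_add_gain:
  "weigh I b x + gain I b i w =
     weigh I b (\<lambda>v. x v + (if favours I i w = v then min \<bar>free_coef I b i\<bar> (need I b v) else 0))"
  unfolding weigh_eq[where v = "favours I i w"] gain_def Let_def by (simp add: algebra_simps)

definition progress :: "ltf_instance \<Rightarrow> (nat \<rightharpoonup> bool) \<Rightarrow> (nat \<rightharpoonup> bool) \<Rightarrow> bool \<Rightarrow> int" where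
  "progress I b b' v = need I b v - need I b' v"

lemma progress_nonneg: "b \<subseteq>\<^sub>m b' \<Longrightarrow> 0 \<le> progress I b b' v"
  using need_antimono by (simp add: progress_def)

lemma progress_upd:
  assumes "b \<subseteq>\<^sub>m b'" "i < dim I" "b' i = None"
  shows "progress I b (b'(i \<mapsto> w)) v =
    progress I b b' v + (if favours I i w = v then \<bar>free_coef I b i\<bar> else 0)"
proof -
  have "b i = None" using assms by (auto simp: map_le_def dom_def)
  then show ?thesis using assms by (simp add: progress_def need_upd free_coef_def)
qed

lemma need_product_le_mean_cost:
  assumes "valid_instance I" "undetermined (ltf I) b" "evaluates (ltf I) (dim I) b T"
  shows "real_of_int (need I b False * need I b True) \<le> mean_cost (prob I) (egain I b) T"
proof -
  let ?Q = "need I b False * need I b True"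
  let ?x = "\<lambda>b' v. min (need I b v) (progress I b b' v)"
  have need: "0 < need I b v" for v using assms(2) by (simp add: undetermined_ltf_iff)
  have "real_of_int ?Q \<le> real_of_int (weigh I b (?x b)) + mean_cost (prob I) (egain I b) T"
  proof (rule mean_cost_ge_potential[OF prob_in_unit[OF assms(1)] assms(3),
        where \<Phi> = "\<lambda>b'. real_of_int (weigh I b (?x b'))"])
    fix b' v assume b': "b \<subseteq>\<^sub>m b'" "certificate (ltf I) b' v"
    then have "?x b' v = need I b v" using need_le_0_iff[of I b' v] by (simp add: progress_def)
    moreover have "0 \<le> ?x b' (\<not> v) * need I b v"
      using progress_nonneg[OF b'(1)] need[THEN less_imp_le] by (intro mult_nonneg_nonneg) simp_all
    ultimately have "need I b v * need I b (\<not> v) \<le> weigh I b (?x b')"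
      unfolding weigh_eq[where v = v] by simp
    then have "?Q \<le> weigh I b (?x b')" by (cases v) (simp_all add: mult.commute)
    then show "real_of_int ?Q \<le> real_of_int (weigh I b (?x b'))" unfolding of_int_le_iff .
  next
    fix b' i w assume b': "b \<subseteq>\<^sub>m b'" "i < dim I" "b' i = None"
    have "min N (y + a) \<le> min N y + min a N" if "0 \<le> y" "0 \<le> N" "0 \<le> a" for N y a :: int
      using that by (auto simp: min_def)
    then have "weigh I b (?x (b'(i \<mapsto> w))) \<le> weigh I b (?x b') + gain I b i w"
      unfolding weigh_add_gain using progress_nonneg[OF b'(1)] need[THEN less_imp_le]
      by (intro weigh_mono[OF assms(2)]) (simp add: progress_upd b')
    then show "real_of_int (weigh I b (?x (b'(i \<mapsto> w))))
        \<le> real_of_int (weigh I b (?x b')) + real_of_int (gain I b i w)"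
      unfolding of_int_add[symmetric] of_int_le_iff .
  qed
  then show ?thesis using need[THEN less_imp_le] by (simp add: weigh_def progress_def min_absorb2)
qed

lemma mean_cost_le_3_need_product:
  assumes "valid_instance I" "undetermined (ltf I) b" "evaluates (ltf I) (dim I) b T"
  shows "mean_cost (prob I) (egain I b) T \<le> 3 * real_of_int (need I b False * need I b True)"
proof -
  let ?Q = "need I b False * need I b True"
  let ?\<Phi> = "\<lambda>b'. min (3 * ?Q) (weigh I b (progress I b b'))"
  have "real_of_int (?\<Phi> b) + mean_cost (prob I) (egain I b) T \<le> real_of_int (3 * ?Q)"
  proof (rule mean_cost_le_potential[OF prob_in_unit[OF assms(1)] assms(3),
        where \<Phi> = "\<lambda>b'. real_of_int (?\<Phi> b')"])
    fix b' i w assume b': "b \<subseteq>\<^sub>m b'" "undetermined (ltf I) b'" "i < dim I" "b' i = None"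
    have "progress I b b' v \<le> need I b v" for v
      using b'(2) by (simp add: progress_def undetermined_ltf_iff less_imp_le)
    then have "weigh I b (progress I b b') \<le> weigh I b (need I b)" by (rule weigh_mono[OF assms(2)])
    then have "weigh I b (progress I b b') + gain I b i w \<le> 3 * ?Q"
      using gain_le[OF assms(2), of i w] by (simp add: weigh_def mult.commute)
    moreover have "weigh I b (progress I b b') + gain I b i w
        \<le> weigh I b (progress I b (b'(i \<mapsto> w)))"
      unfolding weigh_add_gain by (intro weigh_mono[OF assms(2)]) (simp add: progress_upd b')
    ultimately have "?\<Phi> b' + gain I b i w \<le> ?\<Phi> (b'(i \<mapsto> w))"
      using gain_nonneg[OF assms(2), of i w] by linarith
    then show "real_of_int (?\<Phi> b') + real_of_int (gain I b i w) \<le> real_of_int (?\<Phi> (b'(i \<mapsto> w)))"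
      unfolding of_int_add[symmetric] of_int_le_iff .
  qed (simp only: of_int_le_iff min.cobounded1)
  moreover have "0 < need I b v" for v using assms(2) by (simp add: undetermined_ltf_iff)
  ultimately show ?thesis by (simp add: weigh_def progress_def min_absorb2 less_imp_le)
qed

locale valid_ltf =
  fixes I :: ltf_instance
  assumes valid: "valid_instance I"
begin

lemma prob_pos: "i < dim I \<Longrightarrow> 0 < prob I i" and prob_less_1: "i < dim I \<Longrightarrow> prob I i < 1"
  using valid by (auto simp: valid_instance_def)

lemma cost_nonneg: "cost I \<in> {..<dim I} \<rightarrow> {0..}"
  using valid by (auto simp: valid_instance_def)

lemma egain_nonneg: "undetermined (ltf I) b \<Longrightarrow> i < dim I \<Longrightarrow> 0 \<le> egain I b i"
  using gain_nonneg[of I b i] prob_pos[of i] prob_less_1[of i] by (simp add: expected_gain_def)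

lemma egain_pos_iff:
  assumes "undetermined (ltf I) b" "i < dim I"
  shows "0 < egain I b i \<longleftrightarrow> free_coef I b i \<noteq> 0"
proof (cases "free_coef I b i = 0")
  case True
  then have "gain I b i w = 0" for w by (simp add: gain_eq_0_iff[OF assms(1)])
  then have "egain I b i = 0" by (simp add: expected_gain_def)
  then show ?thesis using True by simp
next
  case False
  then have "0 < gain I b i w" for w
    using gain_nonneg[OF assms(1), of i w] gain_eq_0_iff[OF assms(1), of i w] by simp
  then have "0 < egain I b i"
    unfolding expected_gain_def using prob_pos prob_less_1 assms(2)
    by (intro add_pos_pos mult_pos_pos) simp_all
  then show ?thesis using False by simp
qed

sublocale local_ratio "ltf I" "dim I" "prob I" "egain I" 3
proof
  fix b assume und: "undetermined (ltf I) b"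
  show "egain I b \<in> {..<dim I} \<rightarrow> {0..}" using egain_nonneg[OF und] by auto
  have "0 < need I b False" "0 < need I b True" using und by (simp_all add: undetermined_ltf_iff)
  then have "(\<Sum>i<dim I. \<bar>free_coef I b i\<bar>) \<noteq> 0" using sum_need[of I b] by linarith
  then show "\<exists>i<dim I. 0 < egain I b i"
    using egain_pos_iff[OF und] by (metis (no_types, lifting) abs_zero lessThan_iff sum.neutral)
  fix T T' assume "evaluates (ltf I) (dim I) b T" "evaluates (ltf I) (dim I) b T'"
  then show "mean_cost (prob I) (egain I b) T \<le> 3 * mean_cost (prob I) (egain I b) T'"
    using mean_cost_le_3_need_product[OF valid und] need_product_le_mean_cost[OF valid und]
    by fastforce
next
  show "b i = None" if "undetermined (ltf I) b" "i < dim I" "0 < egain I b i" for b i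
    using egain_pos_iff[OF that(1,2)] that(3) by (simp add: free_coef_def split: if_splits)
qed (simp_all add: prob_in_unit[OF valid])

lemma greedy_expected_cost_le:
  assumes "greedy (ltf I) (dim I) (egain I) Map.empty (cost I) T"
  shows "T \<in> strategies I" "expected_cost I T \<le> 3 * opt_cost I"
proof -
  show T: "T \<in> strategies I" using greedy_evaluates[OF assms] by (simp add: strategies_def)
  have "opt_cost I \<in> expected_cost I ` strategies I"
    unfolding opt_cost_def using finite_strategies strategies_nonempty by (intro Min_in) auto
  then obtain T' where T': "T' \<in> strategies I" "opt_cost I = expected_cost I T'" by blast
  have "mean_cost (prob I) (cost I) T \<le> 3 * mean_cost (prob I) (cost I) T'"
    using T'(1) by (intro greedy_approx[OF assms cost_nonneg]) (simp add: strategies_def)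
  then show "expected_cost I T \<le> 3 * opt_cost I"
    using T T' by (simp add: expected_cost_eq_mean_cost valid)
qed

end

section \<open>Numbers of bounded length\<close>

text \<open>The factor \<open>2\<close> makes the bound additive under all four arithmetic operations.\<close>

definition fits_bits :: "nat \<Rightarrow> real \<Rightarrow> bool" where
  "fits_bits e x \<longleftrightarrow>
     (\<exists>k m :: int. x = of_int k / of_int m \<and> 0 < m \<and> 2 * m \<le> 2 ^ e \<and> 2 * \<bar>k\<bar> \<le> 2 ^ e)"

lemma fits_bitsI:
  "x = of_int k / of_int m \<Longrightarrow> 0 < m \<Longrightarrow> 2 * m \<le> 2 ^ e \<Longrightarrow> 2 * \<bar>k\<bar> \<le> 2 ^ e \<Longrightarrow> fits_bits e x"
  unfolding fits_bits_def by blast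

lemma fits_bitsE:
  assumes "fits_bits e x"
  obtains k m :: int where "x = of_int k / of_int m" "0 < m" "2 * m \<le> 2 ^ e" "2 * \<bar>k\<bar> \<le> 2 ^ e"
  using assms unfolding fits_bits_def by blast

lemma fits_bits_mono:
  assumes "fits_bits d x" "d \<le> e"
  shows "fits_bits e x"
proof -
  have "(2::int) ^ d \<le> 2 ^ e" using assms(2) by (intro power_increasing) auto
  then show ?thesis using assms(1) unfolding fits_bits_def by (blast intro: order_trans)
qed

lemma fits_bits_of_int: "\<bar>z\<bar> \<le> 2 ^ e \<Longrightarrow> fits_bits (Suc e) (of_int z)"
  by (rule fits_bitsI[of _ z 1]) auto

lemma four_mult_le_power_add:
  fixes a b :: int
  assumes "0 \<le> a" "0 \<le> b" "2 * a \<le> 2 ^ d" "2 * b \<le> 2 ^ e"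
  shows "4 * (a * b) \<le> 2 ^ (d + e)"
proof -
  have "(2 * a) * (2 * b) \<le> 2 ^ d * 2 ^ e" using assms by (intro mult_mono) auto
  then show ?thesis by (simp add: power_add)
qed

lemma two_mult_le_power_add:
  fixes a b :: int
  assumes "0 \<le> a" "0 \<le> b" "2 * a \<le> 2 ^ d" "2 * b \<le> 2 ^ e"
  shows "2 * (a * b) \<le> 2 ^ (d + e)"
  using four_mult_le_power_add[OF assms] mult_nonneg_nonneg[OF assms(1,2)] by linarith

lemma fits_bits_mult:
  assumes "fits_bits d x" "fits_bits e y"
  shows "fits_bits (d + e) (x * y)"
proof -
  obtain k m where x: "x = of_int k / of_int m" "0 < m" "2 * m \<le> 2 ^ d" "2 * \<bar>k\<bar> \<le> 2 ^ d"
    using assms(1) by (rule fits_bitsE)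
  obtain k' m' where y: "y = of_int k' / of_int m'" "0 < m'" "2 * m' \<le> 2 ^ e" "2 * \<bar>k'\<bar> \<le> 2 ^ e"
    using assms(2) by (rule fits_bitsE)
  show ?thesis
  proof (rule fits_bitsI)
    show "x * y = of_int (k * k') / of_int (m * m')" using x y by simp
    show "0 < m * m'" using x y by simp
    show "2 * (m * m') \<le> 2 ^ (d + e)"
      using x y by (intro two_mult_le_power_add) auto
    show "2 * \<bar>k * k'\<bar> \<le> 2 ^ (d + e)"
      unfolding abs_mult using x y by (intro two_mult_le_power_add) auto
  qed
qed

lemma fits_bits_inverse:
  assumes "fits_bits e x"
  shows "fits_bits e (inverse x)"
proof -
  obtain k m where x: "x = of_int k / of_int m" "0 < m" "2 * m \<le> 2 ^ e" "2 * \<bar>k\<bar> \<le> 2 ^ e"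
    using assms by (rule fits_bitsE)
  consider (zero) "k = 0" | (pos) "0 < k" | (neg) "k < 0" by linarith
  then show ?thesis
  proof cases
    case zero
    then show ?thesis using assms x by simp
  next
    case pos
    then show ?thesis using x by (intro fits_bitsI[of _ m k]) auto
  next
    case neg
    then show ?thesis using x by (intro fits_bitsI[of _ "- m" "- k"]) auto
  qed
qed

lemma fits_bits_divide: "fits_bits d x \<Longrightarrow> fits_bits e y \<Longrightarrow> fits_bits (d + e) (x / y)"
  unfolding divide_inverse by (intro fits_bits_mult fits_bits_inverse)

lemma fits_bits_add:
  assumes "fits_bits d x" "fits_bits e y"
  shows "fits_bits (d + e) (x + y)"
proof -
  obtain k m where x: "x = of_int k / of_int m" "0 < m" "2 * m \<le> 2 ^ d" "2 * \<bar>k\<bar> \<le> 2 ^ d"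
    using assms(1) by (rule fits_bitsE)
  obtain k' m' where y: "y = of_int k' / of_int m'" "0 < m'" "2 * m' \<le> 2 ^ e" "2 * \<bar>k'\<bar> \<le> 2 ^ e"
    using assms(2) by (rule fits_bitsE)
  show ?thesis
  proof (rule fits_bitsI)
    show "x + y = of_int (k * m' + k' * m) / of_int (m * m')" using x y by (simp add: field_simps)
    show "0 < m * m'" using x y by simp
    show "2 * (m * m') \<le> 2 ^ (d + e)"
      using x y by (intro two_mult_le_power_add) auto
    have "\<bar>k * m' + k' * m\<bar> \<le> \<bar>k\<bar> * m' + m * \<bar>k'\<bar>"
      using abs_triangle_ineq[of "k * m'" "k' * m"] x y by (simp add: abs_mult mult.commute)
    moreover have "4 * (\<bar>k\<bar> * m') \<le> 2 ^ (d + e)" "4 * (m * \<bar>k'\<bar>) \<le> 2 ^ (d + e)"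
      using x y by (auto intro!: four_mult_le_power_add)
    moreover have "2 * z \<le> X" if "z \<le> a + b" "4 * a \<le> X" "4 * b \<le> X" for z a b X :: int
      using that by linarith
    ultimately show "2 * \<bar>k * m' + k' * m\<bar> \<le> 2 ^ (d + e)" by blast
  qed
qed

lemma fits_bits_uminus: "fits_bits e x \<Longrightarrow> fits_bits e (- x)"
  by (elim fits_bitsE, rule fits_bitsI[of _ "- k" m for k m]) auto

lemma fits_bits_diff: "fits_bits d x \<Longrightarrow> fits_bits e y \<Longrightarrow> fits_bits (d + e) (x - y)"
  using fits_bits_add[OF _ fits_bits_uminus] by fastforce

lemma fits_bits_imp_abs_le:
  assumes "fits_bits e x"
  shows "\<bar>x\<bar> \<le> 2 ^ e"
proof -
  obtain k m where x: "x = of_int k / of_int m" "0 < m" "2 * \<bar>k\<bar> \<le> 2 ^ e"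
    using assms by (rule fits_bitsE)
  then have "\<bar>x\<bar> \<le> real_of_int \<bar>k\<bar>" by (simp add: divide_le_eq mult_le_cancel_left1)
  also have "\<dots> \<le> real_of_int (2 ^ e)" using x(3) by (simp only: of_int_le_iff)
  finally show ?thesis by simp
qed

lemma fits_bits_of_denominator:
  assumes "of_int m * x \<in> \<int>" "0 < m" "m \<le> 2 ^ d" "\<bar>x\<bar> \<le> 2 ^ e"
  shows "fits_bits (Suc (d + e)) x"
proof -
  obtain k :: int where k: "of_int m * x = of_int k" using assms(1) by (elim Ints_cases)
  have m: "real_of_int m \<le> of_int (2 ^ d)" using assms(3) by (simp only: of_int_le_iff)
  have "real_of_int \<bar>k\<bar> = of_int m * \<bar>x\<bar>" using k assms(2) by (metis abs_mult abs_of_pos of_int_abs)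
  also have "\<dots> \<le> of_int (2 ^ d) * 2 ^ e" using m assms by (intro mult_mono) auto
  also have "\<dots> = of_int (2 ^ (d + e))" by (simp add: power_add)
  finally have "\<bar>k\<bar> \<le> 2 ^ (d + e)" by (simp only: of_int_le_iff)
  moreover have "m \<le> 2 ^ (d + e)" by (rule order_trans[OF assms(3)]) (simp add: power_increasing)
  ultimately show ?thesis using k assms(2) by (intro fits_bitsI[of x k m]) (auto simp: field_simps)
qed

lemma bit_weight_of_rat:
  "bit_weight (of_rat q) =
     (case quotient_of q of (k, m) \<Rightarrow> nat (bitlen \<bar>k\<bar>) + nat (bitlen m) + 1)"
  unfolding bit_weight_def by (simp add: inv_f_f inj_def)

lemma quotient_of_Fract_le:
  assumes "quotient_of (Fract k m) = (k', m')" "0 < m"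
  shows "\<bar>k'\<bar> \<le> \<bar>k\<bar>" "m' \<le> m"
proof -
  have "k' = k div gcd k m" "m' = m div gcd k m" "0 < gcd k m"
    using assms by (auto simp: quotient_of_Fract Rat.normalize_def Let_def)
  then obtain g where g: "0 < g" "k = k' * g" "m = m' * g"
    by (metis dvd_div_mult_self gcd_dvd1 gcd_dvd2)
  then have "0 < m'" using assms(2) by (simp add: zero_less_mult_iff)
  then show "\<bar>k'\<bar> \<le> \<bar>k\<bar>" "m' \<le> m"
    using g by (simp_all add: abs_mult mult_le_cancel_left1)
qed

lemma fits_bits_imp_bit_weight_le:
  assumes "fits_bits e x"
  shows "bit_weight x \<le> 2 * e + 1"
proof -
  obtain k m where x: "x = of_int k / of_int m" "0 < m" "2 * m \<le> 2 ^ e" "2 * \<bar>k\<bar> \<le> 2 ^ e"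
    using assms by (rule fits_bitsE)
  obtain k' m' where q: "quotient_of (Fract k m) = (k', m')" by fastforce
  have "x = of_rat (Fract k m)" using x by (simp add: of_rat_rat)
  then have "bit_weight x = nat (bitlen \<bar>k'\<bar>) + nat (bitlen m') + 1"
    by (simp add: bit_weight_of_rat q)
  moreover have "\<bar>k'\<bar> < 2 ^ e" "m' < 2 ^ e" using quotient_of_Fract_le[OF q x(2)] x(2-4) by auto
  then have "bitlen \<bar>k'\<bar> \<le> int e" "bitlen m' \<le> int e" by (simp_all add: bitlen_le_iff_power)
  ultimately show ?thesis by simp
qed

lemma fits_bits_bit_weight:
  assumes "x \<in> \<rat>"
  shows "fits_bits (bit_weight x) x"
proof -
  obtain q where q: "x = of_rat q" using assms by (auto simp: Rats_def)
  obtain k m where km: "quotient_of q = (k, m)" by fastforce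
  have "0 < m" and x: "x = of_int k / of_int m"
    using quotient_of_denom_pos[OF km] quotient_of_div[OF km] by (simp_all add: q of_rat_divide)
  have w: "bit_weight x = nat (bitlen \<bar>k\<bar>) + nat (bitlen m) + 1"
    by (simp add: q bit_weight_of_rat km)
  have fits: "2 * z \<le> 2 ^ bit_weight x" if "Suc (nat (bitlen z)) \<le> bit_weight x" for z
  proof -
    have "z < 2 ^ nat (bitlen z)" using bitlen_le_iff_power[of z "bitlen z"] by simp
    then have "2 * z \<le> 2 ^ Suc (nat (bitlen z))" by simp
    also have "\<dots> \<le> 2 ^ bit_weight x" using that by (intro power_increasing) auto
    finally show ?thesis .
  qed
  show ?thesis using x \<open>0 < m\<close> by (rule fits_bitsI) (rule fits, simp add: w)+
qed

lemma common_denominator: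
  assumes "finite A" "\<And>i. i \<in> A \<Longrightarrow> fits_bits (e i) (x i)"
  shows "\<exists>D::int. 0 < D \<and> D \<le> 2 ^ (\<Sum>i\<in>A. e i) \<and> (\<forall>i\<in>A. of_int D * x i \<in> \<int>)"
  using assms
proof (induction A)
  case empty
  show ?case by (intro exI[of _ 1]) simp
next
  case (insert j A)
  then obtain D :: int where D: "0 < D" "D \<le> 2 ^ (\<Sum>i\<in>A. e i)" "\<And>i. i \<in> A \<Longrightarrow> of_int D * x i \<in> \<int>"
    by blast
  obtain k m where j: "x j = of_int k / of_int m" "0 < m" "2 * m \<le> 2 ^ e j"
    using insert.prems by (blast elim: fits_bitsE)
  have "of_int (m * D) * x j = of_int (D * k)" using j by simp
  then have "of_int (m * D) * x j \<in> \<int>" by (metis Ints_of_int)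
  moreover have "of_int (m * D) * x i \<in> \<int>" if "i \<in> A" for i
    using Ints_mult[OF Ints_of_int[of m] D(3)[OF that]] by (simp add: mult.assoc)
  moreover have "m * D \<le> 2 ^ e j * 2 ^ (\<Sum>i\<in>A. e i)" using D j by (intro mult_mono) auto
  then have "m * D \<le> 2 ^ (\<Sum>i\<in>insert j A. e i)" using insert.hyps by (simp add: power_add)
  ultimately show ?case using D(1) j(2) by (intro exI[of _ "m * D"]) simp
qed

section \<open>Reduced costs along greedy runs\<close>

abbreviation pick :: "ltf_instance \<Rightarrow> (nat \<rightharpoonup> bool) \<Rightarrow> (nat \<Rightarrow> real) \<Rightarrow> nat" where
  "pick I b \<equiv> cheapest (dim I) (egain I b)"

abbreviation residual :: "ltf_instance \<Rightarrow> (nat \<rightharpoonup> bool) \<Rightarrow> (nat \<Rightarrow> real) \<Rightarrow> nat \<Rightarrow> real" where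
  "residual I b \<equiv> reduced_cost (dim I) (egain I b)"

inductive reachable :: "ltf_instance \<Rightarrow> (nat \<rightharpoonup> bool) \<Rightarrow> (nat \<Rightarrow> real) \<Rightarrow> bool" for I where
  start: "reachable I Map.empty (cost I)"
| step: "reachable I b d \<Longrightarrow> undetermined (ltf I) b \<Longrightarrow>
    reachable I (b(pick I b d \<mapsto> v)) (residual I b d)"

text \<open>
  The summand \<open>int (dim I) + 2\<close> covers the loop counters and the codes \<open>i + 2\<close> of tests.
\<close>
definition magnitude :: "ltf_instance \<Rightarrow> int" where
  "magnitude I = \<bar>threshold I\<bar> + (\<Sum>i<dim I. \<bar>coef I i\<bar>) + int (dim I) + 2"

lemma abs_coef_le_magnitude: "i < dim I \<Longrightarrow> \<bar>coef I i\<bar> \<le> magnitude I"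
  using member_le_sum[of i "{..<dim I}" "\<lambda>i. \<bar>coef I i\<bar>"] by (simp add: magnitude_def)

lemma abs_need_le_magnitude: "\<bar>need I b v\<bar> \<le> magnitude I"
proof -
  have "\<bar>\<Sum>i<dim I. least_term I b v i\<bar> \<le> (\<Sum>i<dim I. \<bar>coef I i\<bar>)"
    by (rule order_trans[OF sum_abs])
      (auto intro!: sum_mono simp: least_term_def orient_def split: option.split)
  moreover have "\<bar>oriented_threshold I v\<bar> \<le> \<bar>threshold I\<bar> + 1"
    by (cases v) (auto simp: oriented_threshold_def)
  ultimately show ?thesis
    unfolding need_def magnitude_def
    using abs_triangle_ineq4[of "oriented_threshold I v" "\<Sum>i<dim I. least_term I b v i"]
    by linarith
qed

lemma dim_le_instance_size: "dim I \<le> instance_size w I"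
proof -
  have "(\<Sum>i<dim I. 1) \<le> (\<Sum>i<dim I. w (of_int (coef I i)) + w (prob I i) + w (cost I i) + 1)"
    by (intro sum_mono) auto
  then show ?thesis by (simp add: instance_size_def)
qed

lemma weight_le_instance_size:
  "w (of_int (threshold I)) \<le> instance_size w I"
  "j < dim I \<Longrightarrow> w (of_int (coef I j)) \<le> instance_size w I"
  "j < dim I \<Longrightarrow> w (cost I j) \<le> instance_size w I"
proof -
  let ?f = "\<lambda>i. w (of_int (coef I i)) + w (prob I i) + w (cost I i) + 1"
  have "?f j \<le> (\<Sum>i<dim I. ?f i)" if "j < dim I" using that by (intro member_le_sum) auto
  then show "w (of_int (threshold I)) \<le> instance_size w I"
    "j < dim I \<Longrightarrow> w (of_int (coef I j)) \<le> instance_size w I"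
    "j < dim I \<Longrightarrow> w (cost I j) \<le> instance_size w I"
    by (auto simp: instance_size_def)
qed

lemma abs_le_two_power_bit_weight:
  assumes "x \<in> \<rat>" "bit_weight x \<le> e"
  shows "\<bar>x\<bar> \<le> 2 ^ e"
  by (intro fits_bits_imp_abs_le fits_bits_mono[OF fits_bits_bit_weight] assms)

lemma magnitude_le: "magnitude I \<le> 2 ^ (2 * instance_size bit_weight I + 3)"
proof -
  let ?L = "instance_size bit_weight I"
  have int: "\<bar>z\<bar> \<le> 2 ^ ?L" if "bit_weight (of_int z) \<le> ?L" for z :: int
    using abs_le_two_power_bit_weight[OF _ that] by (simp flip: of_int_abs of_int_power)
  have threshold: "\<bar>threshold I\<bar> \<le> 2 ^ ?L" by (rule int[OF weight_le_instance_size(1)])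
  have "(\<Sum>i<dim I. \<bar>coef I i\<bar>) \<le> of_nat (card {..<dim I}) * 2 ^ ?L"
    by (intro sum_bounded_above) (auto intro: int weight_le_instance_size(2))
  then have coef: "(\<Sum>i<dim I. \<bar>coef I i\<bar>) \<le> int (dim I) * 2 ^ ?L" by simp
  have dim: "int (dim I) \<le> 2 ^ ?L"
    using dim_le_instance_size[of I bit_weight] of_nat_less_two_power[of ?L, where 'a = int]
    by linarith
  then have "int (dim I) * 2 ^ ?L \<le> 2 ^ ?L * 2 ^ ?L" by (intro mult_right_mono) auto
  moreover have "(2::int) ^ ?L * 1 \<le> 2 ^ ?L * 2 ^ ?L" by (intro mult_left_mono) auto
  moreover have "(1::int) \<le> 2 ^ ?L" by simp
  ultimately have "magnitude I \<le> 8 * (2 ^ ?L * 2 ^ ?L)"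
    using threshold coef dim unfolding magnitude_def by linarith
  also have "8 * (2 ^ ?L * 2 ^ ?L) = (2::int) ^ (2 * ?L + 3)"
    unfolding mult_2 power_add by simp
  finally show ?thesis .
qed

lemma common_denominator_instance:
  assumes "rational_instance I"
  shows "\<exists>D::int. 0 < D \<and> D \<le> 2 ^ instance_size bit_weight I \<and>
    (\<forall>i<dim I. of_int D * prob I i \<in> \<int> \<and> of_int D * cost I i \<in> \<int>)"
proof -
  let ?A = "{..<dim I} <+> {..<dim I}" and ?x = "case_sum (prob I) (cost I)"
  have "\<exists>D::int. 0 < D \<and> D \<le> 2 ^ (\<Sum>j\<in>?A. bit_weight (?x j)) \<and> (\<forall>j\<in>?A. of_int D * ?x j \<in> \<int>)"
    using assms
    by (intro common_denominator fits_bits_bit_weight) (auto simp: rational_instance_def)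
  then obtain D :: int where D: "0 < D" "D \<le> 2 ^ (\<Sum>j\<in>?A. bit_weight (?x j))"
    "\<forall>j\<in>?A. of_int D * ?x j \<in> \<int>" by blast
  have "(\<Sum>j\<in>?A. bit_weight (?x j)) \<le> instance_size bit_weight I"
    unfolding instance_size_def
    by (simp add: sum.Plus flip: sum.distrib) (intro trans_le_add2 sum_mono, simp)
  then have "(2::int) ^ (\<Sum>j\<in>?A. bit_weight (?x j)) \<le> 2 ^ instance_size bit_weight I"
    by (intro power_increasing) auto
  moreover have "of_int D * prob I i \<in> \<int>" "of_int D * cost I i \<in> \<int>" if "i < dim I" for i
    using D(3)[rule_format, of "Inl i"] D(3)[rule_format, of "Inr i"] that by auto
  ultimately show ?thesis using D(1) order_trans[OF D(2)] by blast
qed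

context valid_ltf
begin

lemma reachable_dom: "reachable I b d \<Longrightarrow> dom b \<subseteq> {..<dim I}"
  by (induction rule: reachable.induct) (simp_all add: cheapest_less del: fun_upd_apply)

lemma reachable_cost_bounds:
  assumes "reachable I b d"
  shows "j < dim I \<Longrightarrow> 0 \<le> d j \<and> d j \<le> cost I j"
  using assms
proof (induction arbitrary: j)
  case start
  then show ?case using cost_nonneg by auto
next
  case (step b d v)
  then have "d \<in> {..<dim I} \<rightarrow> {0..}" by auto
  from reduced_cost_nonneg[OF step.hyps(2) this step.prems]
    reduced_cost_le[OF step.hyps(2) this step.prems] step.IH[OF step.prems]
  show ?case by linarith
qed

lemma egain_le:
  assumes "undetermined (ltf I) b" "i < dim I"
  shows "egain I b i \<le> of_int (magnitude I ^ 2)"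
proof -
  have need: "0 \<le> need I b v" "need I b v \<le> magnitude I" for v
    using assms(1) abs_need_le_magnitude[of I b v] by (auto simp: undetermined_ltf_iff less_imp_le)
  have "gain I b i w \<le> magnitude I ^ 2" for w
    using gain_le[OF assms(1)] mult_mono[OF need(2) need(2) _ need(1)] need
    by (metis order_trans power2_eq_square)
  then have g: "real_of_int (gain I b i w) \<le> of_int (magnitude I ^ 2)" for w
    by (simp only: of_int_le_iff)
  have "egain I b i
      \<le> (1 - prob I i) * of_int (magnitude I ^ 2) + prob I i * of_int (magnitude I ^ 2)"
    unfolding expected_gain_def
    using g prob_pos[OF assms(2)] prob_less_1[OF assms(2)] by (intro add_mono mult_left_mono) auto
  then show ?thesis by (simp add: algebra_simps)
qed

lemma denominator_egain:
  assumes "of_int D * prob I i \<in> \<int>"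
  shows "of_int D * egain I b i \<in> \<int>"
proof -
  have "of_int D * egain I b i = (of_int D - of_int D * prob I i) * of_int (gain I b i False) +
      (of_int D * prob I i) * of_int (gain I b i True)"
    by (simp add: expected_gain_def algebra_simps)
  also have "\<dots> \<in> \<int>"
    by (intro Ints_add Ints_mult[OF Ints_diff[OF Ints_of_int assms] Ints_of_int]
        Ints_mult[OF assms Ints_of_int])
  finally show ?thesis .
qed

text \<open>
  A round multiplies the common denominator of the reduced costs only by the numerator of the gain
  of the picked variable, so it stays of polynomial length although the recursion for the reduced
  costs is quadratic.
\<close>

lemma denominator_residual:
  assumes "undetermined (ltf I) b" "0 < D"
    and "\<And>i. i < dim I \<Longrightarrow> of_int D * prob I i \<in> \<int>" "\<And>i. i < dim I \<Longrightarrow> of_int M * d i \<in> \<int>"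
  shows "\<exists>G::int. 0 < G \<and> G \<le> D * magnitude I ^ 2 \<and>
    (\<forall>i<dim I. of_int (M * G) * residual I b d i \<in> \<int>)"
proof -
  let ?k = "pick I b d"
  note k = cheapest_less[OF assms(1), of d] cheapest_charge_pos[OF assms(1), of d]
  have gain: "of_int D * egain I b i \<in> \<int>" if "i < dim I" for i
    using assms(3)[OF that] by (rule denominator_egain)
  then obtain G where G: "of_int D * egain I b ?k = of_int G" using k(1) by (blast elim: Ints_cases)
  have "0 < real_of_int G" unfolding G[symmetric] using k(2) assms(2) by simp
  moreover have "real_of_int G \<le> of_int D * of_int (magnitude I ^ 2)"
    unfolding G[symmetric] using egain_le[OF assms(1) k(1)] assms(2) by (intro mult_left_mono) auto
  then have "G \<le> D * magnitude I ^ 2" by (simp only: of_int_mult[symmetric] of_int_le_iff)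
  moreover have "of_int (M * G) * residual I b d i \<in> \<int>" if "i < dim I" for i
  proof -
    have "of_int (M * G) * residual I b d i =
        of_int G * (of_int M * d i) - (of_int M * d ?k) * (of_int D * egain I b i)"
      unfolding reduced_cost_def using k(2) by (simp add: G[symmetric] field_simps)
    also have "\<dots> \<in> \<int>"
      by (intro Ints_diff Ints_mult[OF Ints_of_int assms(4)] Ints_mult[OF assms(4) gain] that k(1))
    finally show ?thesis .
  qed
  ultimately show ?thesis by auto
qed

lemma denominator_reachable:
  assumes "reachable I b d" "0 < D"
    and D: "\<And>i. i < dim I \<Longrightarrow> of_int D * prob I i \<in> \<int>" "\<And>i. i < dim I \<Longrightarrow> of_int D * cost I i \<in> \<int>"
  shows "\<exists>M::int. 0 < M \<and> M \<le> D * (D * magnitude I ^ 2) ^ card (dom b) \<and>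
    (\<forall>i<dim I. of_int M * d i \<in> \<int>)"
  using assms(1)
proof induction
  case start
  then show ?case using assms by (intro exI[of _ D]) auto
next
  case (step b d v)
  let ?k = "pick I b d" and ?X = "D * magnitude I ^ 2"
  obtain M :: int where M: "0 < M" "M \<le> D * ?X ^ card (dom b)" "\<And>i. i < dim I \<Longrightarrow> of_int M * d i \<in> \<int>"
    using step.IH by blast
  obtain G :: int where G: "0 < G" "G \<le> ?X" "\<forall>i<dim I. of_int (M * G) * residual I b d i \<in> \<int>"
    using denominator_residual[where M = M and d = d, OF step.hyps(2) assms(2)] D(1) M(3) by blast
  have "card (dom (b(?k \<mapsto> v))) = Suc (card (dom b))"
    using finite_subset[OF reachable_dom[OF step.hyps(1)]] cheapest_None[OF step.hyps(2)]
    by (simp add: domIff)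
  moreover have "M * G \<le> (D * ?X ^ card (dom b)) * ?X" using M(1,2) G(1,2) by (intro mult_mono) auto
  ultimately have "M * G \<le> D * ?X ^ card (dom (b(?k \<mapsto> v)))" by (simp only: power_Suc2 mult.assoc)
  then show ?case
    using M(1) G(1,3) by (intro exI[of _ "M * G"]) (simp del: fun_upd_apply dom_fun_upd)
qed

end

locale rational_ltf = valid_ltf +
  assumes rational: "rational_instance I"
begin

abbreviation "bits \<equiv> instance_size bit_weight I"

definition denom :: int where
  "denom = (SOME D. 0 < D \<and> D \<le> 2 ^ bits \<and>
    (\<forall>i<dim I. of_int D * prob I i \<in> \<int> \<and> of_int D * cost I i \<in> \<int>))"

lemma denom: "0 < denom" "denom \<le> 2 ^ bits"
  "i < dim I \<Longrightarrow> of_int denom * prob I i \<in> \<int>" "i < dim I \<Longrightarrow> of_int denom * cost I i \<in> \<int>"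
  using someI_ex[OF common_denominator_instance[OF rational]] unfolding denom_def[symmetric]
  by blast+

lemma magnitude_pos: "0 < magnitude I"
  by (simp add: magnitude_def add_nonneg_pos sum_nonneg)

lemma magnitude_square_le: "magnitude I ^ 2 \<le> 2 ^ (4 * bits + 6)"
proof -
  have "magnitude I ^ 2 \<le> (2 ^ (2 * bits + 3)) ^ 2"
    using magnitude_le magnitude_pos by (intro power_mono) auto
  then show ?thesis by (simp flip: power_mult add: algebra_simps)
qed

lemma fits_prob:
  assumes "i < dim I"
  shows "fits_bits (Suc bits) (prob I i)"
  using prob_pos[OF assms] prob_less_1[OF assms]
  by (intro fits_bits_of_denominator[OF denom(3)[OF assms] denom(1,2), of 0, simplified]) simp

lemma fits_egain:
  assumes "undetermined (ltf I) b" "i < dim I"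
  shows "fits_bits (5 * bits + 7) (egain I b i)"
proof -
  have "\<bar>egain I b i\<bar> = egain I b i" using egain_nonneg[OF assms] by simp
  also have "\<dots> \<le> of_int (magnitude I ^ 2)" by (rule egain_le[OF assms])
  also have "\<dots> \<le> of_int (2 ^ (4 * bits + 6))"
    using magnitude_square_le by (simp only: of_int_le_iff)
  finally have "\<bar>egain I b i\<bar> \<le> 2 ^ (4 * bits + 6)" by simp
  from fits_bits_of_denominator[OF denominator_egain[OF denom(3)[OF assms(2)]] denom(1,2) this]
  show ?thesis by (rule fits_bits_mono) simp
qed

lemma fits_reachable:
  assumes "reachable I b d" "j < dim I"
  shows "fits_bits (5 * bits * bits + 8 * bits + 1) (d j)"
proof -
  obtain M :: int where M: "0 < M" "M \<le> denom * (denom * magnitude I ^ 2) ^ card (dom b)"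
    "of_int M * d j \<in> \<int>"
    using denominator_reachable[OF assms(1) denom(1,3,4)] assms(2) by blast
  have "card (dom b) \<le> card {..<dim I}" by (intro card_mono reachable_dom[OF assms(1)]) simp
  then have "card (dom b) \<le> bits" using dim_le_instance_size[of I bit_weight] by simp
  have "denom * magnitude I ^ 2 \<le> 2 ^ bits * 2 ^ (4 * bits + 6)"
    using denom(1,2) magnitude_square_le by (intro mult_mono) auto
  then have "(denom * magnitude I ^ 2) ^ card (dom b) \<le> (2 ^ (5 * bits + 6)) ^ card (dom b)"
    using denom(1) by (intro power_mono) (simp_all flip: power_add)
  also have "\<dots> \<le> (2 ^ (5 * bits + 6)) ^ bits"
    using \<open>card (dom b) \<le> bits\<close> by (intro power_increasing) auto
  finally have "denom * (denom * magnitude I ^ 2) ^ card (dom b)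
      \<le> 2 ^ bits * (2 ^ (5 * bits + 6)) ^ bits"
    using denom(1,2) by (intro mult_mono) auto
  also have "\<dots> = 2 ^ (bits + (5 * bits + 6) * bits)" by (simp only: power_mult power_add)
  finally have "M \<le> 2 ^ (bits + (5 * bits + 6) * bits)" using M(2) by linarith
  moreover have "\<bar>cost I j\<bar> \<le> 2 ^ bits"
    using rational assms(2)
    by (intro abs_le_two_power_bit_weight weight_le_instance_size(3))
      (auto simp: rational_instance_def)
  then have "\<bar>d j\<bar> \<le> 2 ^ bits" using reachable_cost_bounds[OF assms] by linarith
  ultimately have "fits_bits (Suc (bits + (5 * bits + 6) * bits + bits)) (d j)"
    by (intro fits_bits_of_denominator[OF M(3,1)])
  then show ?thesis by (rule fits_bits_mono) (simp add: algebra_simps)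
qed

end

section \<open>Running time of programs\<close>

text \<open>
  Literals are counted in unary, so that the size bounds the lengths of the values of subexpressions
  as well as their number.
\<close>

fun iexp_size :: "iexp \<Rightarrow> nat" where
  "iexp_size (IConst k) = Suc k"
| "iexp_size (IVar x) = 1"
| "iexp_size (IAdd d e) = iexp_size d + iexp_size e"
| "iexp_size (ISub d e) = iexp_size d + iexp_size e"

fun rexp_size :: "rexp \<Rightarrow> nat" where
  "rexp_size (RConst k) = Suc (nat \<bar>k\<bar>)"
| "rexp_size (RNat e) = Suc (iexp_size e)"
| "rexp_size (RArr x e) = Suc (iexp_size e)"
| "rexp_size (RAdd d e) = rexp_size d + rexp_size e"
| "rexp_size (RSub d e) = rexp_size d + rexp_size e"
| "rexp_size (RMul d e) = rexp_size d + rexp_size e"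
| "rexp_size (RDiv d e) = rexp_size d + rexp_size e"

fun bexp_size :: "bexp \<Rightarrow> nat" where
  "bexp_size (ILess d e) = iexp_size d + iexp_size e"
| "bexp_size (RLess d e) = rexp_size d + rexp_size e"
| "bexp_size (BNot d) = Suc (bexp_size d)"
| "bexp_size (BAnd d e) = bexp_size d + bexp_size e"

lemma iexp_size_pos: "0 < iexp_size e"
  by (induction e) auto

lemma rexp_size_pos: "0 < rexp_size e"
  by (induction e) auto

lemma bexp_size_pos: "0 < bexp_size e"
  by (induction e) (auto simp: iexp_size_pos rexp_size_pos)

definition set_nvar :: "vname \<Rightarrow> nat \<Rightarrow> state \<Rightarrow> state" where
  "set_nvar x v s = s\<lparr>nvar := (nvar s)(x := v)\<rparr>"

definition set_arr :: "vname \<Rightarrow> nat \<Rightarrow> real \<Rightarrow> state \<Rightarrow> state" where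
  "set_arr x i v s = s\<lparr>arr := (arr s)(x := (arr s x)(i := v))\<rparr>"

lemma set_nvar_simps [simp]:
  "nvar (set_nvar x v s) y = (if y = x then v else nvar s y)"
  "arr (set_nvar x v s) = arr s"
  by (auto simp: set_nvar_def)

lemma set_arr_simps [simp]:
  "nvar (set_arr x i r s) = nvar s"
  "arr (set_arr x i r s) y l = (if y = x \<and> l = i then r else arr s y l)"
  by (auto simp: set_arr_def)

text \<open>
  \<open>fits e x\<close> bounds the length of \<open>x\<close> by \<open>e\<close>; it is vacuous for the unit weight and \<^const>\<open>fits_bits\<close>
  for the bit weight.
\<close>

locale number_length =
  fixes w :: "real \<Rightarrow> nat" and fits :: "nat \<Rightarrow> real \<Rightarrow> bool"
  assumes fits_mono: "fits d x \<Longrightarrow> d \<le> e \<Longrightarrow> fits e x"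
    and fits_of_int: "\<bar>z\<bar> \<le> 2 ^ e \<Longrightarrow> fits (Suc e) (of_int z)"
    and fits_add: "fits d x \<Longrightarrow> fits e y \<Longrightarrow> fits (d + e) (x + y)"
    and fits_diff: "fits d x \<Longrightarrow> fits e y \<Longrightarrow> fits (d + e) (x - y)"
    and fits_mult: "fits d x \<Longrightarrow> fits e y \<Longrightarrow> fits (d + e) (x * y)"
    and fits_divide: "fits d x \<Longrightarrow> fits e y \<Longrightarrow> fits (d + e) (x / y)"
    and weight_le: "fits e x \<Longrightarrow> w x \<le> 2 * e + 1"

locale bounded_machine = number_length +
  fixes E :: nat
  assumes E_pos: "0 < E"
begin

definition fits_state :: "state \<Rightarrow> bool" where
  "fits_state s \<longleftrightarrow> (\<forall>x. fits E (real (nvar s x))) \<and> (\<forall>x i. fits E (arr s x i))"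

lemma fits_literal: "fits (Suc (nat \<bar>k\<bar>) * E) (of_int k)"
proof (rule fits_mono)
  have "int (nat \<bar>k\<bar>) < 2 ^ nat \<bar>k\<bar>" by (rule of_nat_less_two_power)
  then show "fits (Suc (nat \<bar>k\<bar>)) (of_int k)" by (intro fits_of_int) simp
  show "Suc (nat \<bar>k\<bar>) \<le> Suc (nat \<bar>k\<bar>) * E" using E_pos by (cases E) simp_all
qed

lemma fits_mono_size: "fits (k * E) x \<Longrightarrow> k \<le> l \<Longrightarrow> fits (l * E) x"
  by (erule fits_mono) (rule mult_le_mono1)

lemma quadratic_Suc:
  fixes k :: nat
  assumes "a \<le> 3 * E * k\<^sup>2" "c \<le> 2 * (k * E) + 1"
  shows "a + c \<le> 3 * E * (Suc k)\<^sup>2"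
proof -
  have "3 * E * (Suc k)\<^sup>2 = 3 * E * k\<^sup>2 + 6 * (k * E) + 3 * E"
    by (simp add: power2_eq_square algebra_simps)
  then show ?thesis using assms E_pos by linarith
qed

lemma quadratic_add:
  fixes m n :: nat
  assumes "a \<le> 3 * E * m\<^sup>2" "b \<le> 3 * E * n\<^sup>2" "c \<le> 2 * ((m + n) * E) + 1" "0 < m" "0 < n"
  shows "a + b + c \<le> 3 * E * (m + n)\<^sup>2"
proof -
  have "m \<le> m * n" "n \<le> m * n" using assms(4,5) by simp_all
  then have "(m + n) * E \<le> (2 * (m * n)) * E" by (intro mult_le_mono1) linarith
  moreover have "1 \<le> (m * n) * E" using assms(4,5) E_pos by simp
  moreover have "3 * E * (m + n)\<^sup>2 = 3 * E * m\<^sup>2 + 3 * E * n\<^sup>2 + 6 * ((m * n) * E)"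
    by (simp add: power2_eq_square algebra_simps)
  ultimately show ?thesis using assms(1-3) by linarith
qed

lemma weight_le_quadratic:
  assumes "fits (k * E) x" "0 < k"
  shows "w x \<le> 3 * E * k\<^sup>2"
proof -
  have "1 \<le> k * E" using assms(2) E_pos by (simp add: Suc_le_eq)
  then have "w x \<le> 3 * (k * E)" using weight_le[OF assms(1)] by linarith
  also have "\<dots> \<le> 3 * (k * E) * k" using assms(2) by simp
  finally show ?thesis by (simp add: power2_eq_square algebra_simps)
qed

lemma iexp_bounds:
  assumes "fits_state s"
  shows "fits (iexp_size e * E) (real (ival e s)) \<and> icost w e s \<le> 3 * E * (iexp_size e)\<^sup>2"
proof (induction e)
  case (IConst k)
  then show ?case using fits_literal[of "int k"] weight_le_quadratic[of "Suc k" "real k"] by simp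
next
  case (IVar x)
  then show ?case
    using assms weight_le_quadratic[of 1 "real (nvar s x)"] by (simp add: fits_state_def)
next
  case (IAdd d e)
  then have "fits (iexp_size (IAdd d e) * E) (real (ival (IAdd d e) s))"
    using fits_add by (fastforce simp: distrib_right)
  then show ?case
    using IAdd quadratic_add[OF _ _ weight_le iexp_size_pos iexp_size_pos] by simp
next
  case (ISub d e)
  have "fits (iexp_size (ISub d e) * E) (real (ival d s - ival e s))"
  proof (cases "ival e s \<le> ival d s")
    case True
    then show ?thesis using ISub fits_diff by (fastforce simp: distrib_right)
  next
    case False
    then show ?thesis using fits_mono_size[OF fits_literal[of 0]] iexp_size_pos[of d] by simp
  qed
  then show ?case
    using ISub quadratic_add[OF _ _ weight_le iexp_size_pos iexp_size_pos] by simp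
qed

lemma rexp_bounds:
  assumes "fits_state s"
  shows "fits (rexp_size e * E) (rval e s) \<and> rcost w e s \<le> 3 * E * (rexp_size e)\<^sup>2"
proof (induction e)
  case (RConst k)
  then show ?case
    using fits_literal[of k] weight_le_quadratic[of "Suc (nat \<bar>k\<bar>)" "of_int k"] by simp
next
  case (RNat e)
  have "fits (iexp_size e * E) (real (ival e s))" "icost w e s \<le> 3 * E * (iexp_size e)\<^sup>2"
    using iexp_bounds[OF assms] by auto
  moreover from this(1) have "fits (Suc (iexp_size e) * E) (real (ival e s))"
    by (rule fits_mono_size) simp
  ultimately show ?case using quadratic_Suc[OF _ weight_le] by simp
next
  case (RArr x e)
  have "fits (1 * E) (arr s x (ival e s))" using assms by (simp add: fits_state_def)
  then have "fits (iexp_size e * E) (arr s x (ival e s))"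
    "fits (Suc (iexp_size e) * E) (arr s x (ival e s))"
    by (rule fits_mono_size, simp add: Suc_le_eq iexp_size_pos)+
  moreover have "icost w e s \<le> 3 * E * (iexp_size e)\<^sup>2" using iexp_bounds[OF assms] by auto
  ultimately show ?case using quadratic_Suc[OF _ weight_le] by simp
next
  case (RAdd d e)
  then show ?case
    using fits_add[of "rexp_size d * E" _ "rexp_size e * E"]
      quadratic_add[OF _ _ weight_le rexp_size_pos rexp_size_pos]
    by (simp add: distrib_right)
next
  case (RSub d e)
  then show ?case
    using fits_diff[of "rexp_size d * E" _ "rexp_size e * E"]
      quadratic_add[OF _ _ weight_le rexp_size_pos rexp_size_pos]
    by (simp add: distrib_right)
next
  case (RMul d e)
  then show ?case
    using fits_mult[of "rexp_size d * E" _ "rexp_size e * E"]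
      quadratic_add[OF _ _ weight_le rexp_size_pos rexp_size_pos]
    by (simp add: distrib_right)
next
  case (RDiv d e)
  then show ?case
    using fits_divide[of "rexp_size d * E" _ "rexp_size e * E"]
      quadratic_add[OF _ _ weight_le rexp_size_pos rexp_size_pos]
    by (simp add: distrib_right)
qed

lemma bcost_le:
  assumes "fits_state s"
  shows "bcost w e s \<le> 3 * E * (bexp_size e)\<^sup>2"
proof (induction e)
  case (ILess d e)
  then show ?case
    using quadratic_add[of "icost w d s" _ "icost w e s" _ 1] iexp_bounds[OF assms] iexp_size_pos
    by simp
next
  case (RLess d e)
  then show ?case
    using quadratic_add[of "rcost w d s" _ "rcost w e s" _ 1] rexp_bounds[OF assms] rexp_size_pos
    by simp
next
  case (BNot e)
  then show ?case using quadratic_Suc[of "bcost w e s" _ 1] by simp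
next
  case (BAnd d e)
  then show ?case
    using quadratic_add[of "bcost w d s" _ "bcost w e s" _ 1] bexp_size_pos by simp
qed

text \<open>
  A step evaluates at most two expressions. All expressions below have size at most \<open>20\<close>, hence
  cost at most \<open>3 * 20\<^sup>2 * E\<close>.
\<close>

definition step_time :: nat where
  "step_time = 2500 * E"

lemma
  assumes "fits_state s"
  shows icost_le: "iexp_size d \<le> 20 \<Longrightarrow> icost w d s \<le> 1200 * E"
    and rcost_le: "rexp_size e \<le> 20 \<Longrightarrow> rcost w e s \<le> 1200 * E"
    and bcost_le_step_time: "bexp_size c \<le> 20 \<Longrightarrow> bcost w c s \<le> step_time"
proof -
  have bound: "3 * E * k\<^sup>2 \<le> 1200 * E" if "k \<le> 20" for k :: nat
  proof -
    have "k\<^sup>2 \<le> 20\<^sup>2" using that by (rule power_mono) simp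
    then have "3 * E * k\<^sup>2 \<le> 3 * E * 400" by (intro mult_le_mono2) simp
    then show ?thesis by simp
  qed
  show "iexp_size d \<le> 20 \<Longrightarrow> icost w d s \<le> 1200 * E"
    using iexp_bounds[OF assms] bound order_trans by blast
  show "rexp_size e \<le> 20 \<Longrightarrow> rcost w e s \<le> 1200 * E"
    using rexp_bounds[OF assms] bound order_trans by blast
  assume "bexp_size c \<le> 20"
  then have "bcost w c s \<le> 1200 * E" using bcost_le[OF assms] bound order_trans by blast
  then show "bcost w c s \<le> step_time" by (simp add: step_time_def)
qed

definition runs :: "com \<Rightarrow> state \<Rightarrow> nat \<Rightarrow> (state \<Rightarrow> bool) \<Rightarrow> bool" where
  "runs P s k Q \<longleftrightarrow>
     (fits_state s \<longrightarrow> (\<exists>t s'. exec w P s t s' \<and> t \<le> k * step_time \<and> fits_state s' \<and> Q s'))"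

lemma runs_mono:
  assumes "runs P s k Q" "k \<le> k'" "\<And>s. Q s \<Longrightarrow> Q' s"
  shows "runs P s k' Q'"
  using assms unfolding runs_def by (meson mult_le_mono1 order_trans)

lemma runs_steps_mono: "runs P s k Q \<Longrightarrow> k \<le> k' \<Longrightarrow> runs P s k' Q"
  by (rule runs_mono)

lemma runs_Skip: "Q s \<Longrightarrow> runs Skip s 1 Q"
  unfolding runs_def using exec.Skip[of w s] E_pos by (fastforce simp: step_time_def)

lemma runs_IAssign:
  assumes "Q (set_nvar x v s)" "ival e s = v" "fits E (real v)" "iexp_size e \<le> 20"
  shows "runs (IAssign x e) s 1 Q"
  unfolding runs_def
proof (intro impI exI conjI)
  assume s: "fits_state s"
  show "exec w (IAssign x e) s (icost w e s + 1) (set_nvar x v s)"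
    unfolding set_nvar_def assms(2)[symmetric] by (rule exec.IAssign)
  show "icost w e s + 1 \<le> 1 * step_time"
    using icost_le[OF s assms(4)] E_pos by (simp add: step_time_def)
  show "fits_state (set_nvar x v s)" using s assms(3) by (simp add: fits_state_def)
qed (rule assms(1))

lemma runs_RAssign:
  assumes "Q (set_arr x i v s)" "ival d s = i" "rval e s = v" "fits E v"
    "iexp_size d \<le> 20" "rexp_size e \<le> 20"
  shows "runs (RAssign x d e) s 1 Q"
  unfolding runs_def
proof (intro impI exI conjI)
  assume s: "fits_state s"
  show "exec w (RAssign x d e) s (icost w d s + rcost w e s + 1) (set_arr x i v s)"
    unfolding set_arr_def assms(2,3)[symmetric] by (rule exec.RAssign)
  show "icost w d s + rcost w e s + 1 \<le> 1 * step_time"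
    using icost_le[OF s assms(5)] rcost_le[OF s assms(6)] E_pos by (simp add: step_time_def)
  show "fits_state (set_arr x i v s)" using s assms(4) by (simp add: fits_state_def)
qed (rule assms(1))

lemma runs_Seq:
  assumes "runs P s k (\<lambda>s'. runs P' s' k' Q)"
  shows "runs (Seq P P') s (k + k') Q"
  unfolding runs_def
proof
  assume "fits_state s"
  then obtain t s' u s'' where run: "exec w P s t s'" "t \<le> k * step_time"
    "exec w P' s' u s''" "u \<le> k' * step_time" "fits_state s''" "Q s''"
    using assms unfolding runs_def by blast
  then have "t + u \<le> (k + k') * step_time" by (simp add: distrib_right)
  with run exec.Seq
  show "\<exists>t s'. exec w (Seq P P') s t s' \<and> t \<le> (k + k') * step_time \<and> fits_state s' \<and> Q s'"
    by blast
qed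

lemma runs_Cond:
  assumes "bexp_size c \<le> 20" "bval c s \<Longrightarrow> runs P s k Q" "\<not> bval c s \<Longrightarrow> runs P' s k Q"
  shows "runs (Cond c P P') s (Suc k) Q"
  unfolding runs_def
proof
  assume s: "fits_state s"
  then obtain t s' where run: "exec w (if bval c s then P else P') s t s'" "t \<le> k * step_time"
    "fits_state s'" "Q s'"
    using assms(2,3) unfolding runs_def by (cases "bval c s") auto
  then have "exec w (Cond c P P') s (bcost w c s + t) s'"
    by (cases "bval c s") (auto intro: exec.CondTrue exec.CondFalse)
  moreover have "bcost w c s + t \<le> Suc k * step_time"
    using bcost_le_step_time[OF s assms(1)] run(2) by simp
  ultimately
  show "\<exists>t s'. exec w (Cond c P P') s t s' \<and> t \<le> Suc k * step_time \<and> fits_state s' \<and> Q s'"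
    using run by blast
qed

lemma runs_Cond_RAssign:
  assumes "Q (set_arr x l v s)" "(if bval c s then ival i s else ival i' s) = l"
    "(if bval c s then rval d s else rval e s) = v" "fits E v"
    "bexp_size c \<le> 20" "iexp_size i \<le> 20" "iexp_size i' \<le> 20" "rexp_size d \<le> 20" "rexp_size e \<le> 20"
  shows "runs (Cond c (RAssign x i d) (RAssign x i' e)) s 2 Q"
proof -
  have "runs (Cond c (RAssign x i d) (RAssign x i' e)) s (Suc 1) Q"
    using assms by (intro runs_Cond runs_RAssign[where i = l and v = v]) auto
  then show ?thesis by (simp add: numeral_2_eq_2)
qed

lemma runs_While_False:
  assumes "bexp_size c \<le> 20" "\<not> bval c s" "Q s"
  shows "runs (While c P) s 1 Q"
  unfolding runs_def using exec.WhileFalse[OF assms(2)] bcost_le_step_time[OF _ assms(1)] assms(3)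
  by (metis mult_1)

lemma runs_While_True:
  assumes "bexp_size c \<le> 20" "bval c s" "runs P s k (\<lambda>s'. runs (While c P) s' k' Q)"
  shows "runs (While c P) s (Suc (k + k')) Q"
  unfolding runs_def
proof
  assume s: "fits_state s"
  then obtain t s' u s'' where run: "exec w P s t s'" "t \<le> k * step_time"
    "exec w (While c P) s' u s''" "u \<le> k' * step_time" "fits_state s''" "Q s''"
    using assms(3) unfolding runs_def by blast
  have "exec w (While c P) s (bcost w c s + t + u) s''" using exec.WhileTrue[OF assms(2) run(1,3)] .
  moreover have "bcost w c s + t + u \<le> Suc (k + k') * step_time"
    using bcost_le_step_time[OF s assms(1)] run(2,4) by (simp add: distrib_right)
  ultimately
  show "\<exists>t s'. exec w (While c P) s t s' \<and> t \<le> Suc (k + k') * step_time \<and> fits_state s' \<and> Q s'"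
    using run by blast
qed

end

abbreviation For :: "com \<Rightarrow> com" where
  "For P \<equiv> Seq (IAssign ''j'' (IConst 0))
     (While (ILess (IVar ''j'') (IVar ''n''))
       (Seq P (IAssign ''j'' (IAdd (IVar ''j'') (IConst 1)))))"

definition loop_step :: "(nat \<Rightarrow> state \<Rightarrow> bool) \<Rightarrow> nat \<Rightarrow> nat \<Rightarrow> state \<Rightarrow> bool" where
  "loop_step Inv n i s \<longleftrightarrow>
     Inv (Suc i) (set_nvar ''j'' (Suc i) s) \<and> nvar s ''j'' = i \<and> nvar s ''n'' = n"

lemma (in bounded_machine) runs_For:
  assumes "Inv 0 (set_nvar ''j'' 0 s)" "nvar s ''n'' = n"
    and fit: "\<And>i. i \<le> n \<Longrightarrow> fits E (real i)"
    and body: "\<And>i s. i < n \<Longrightarrow> Inv i s \<Longrightarrow> nvar s ''j'' = i \<Longrightarrow> nvar s ''n'' = n \<Longrightarrow>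
      runs P s k (loop_step Inv n i)"
  shows "runs (For P) s (2 + n * (k + 2)) (Inv n)"
proof -
  let ?c = "ILess (IVar ''j'') (IVar ''n'')"
  let ?P = "Seq P (IAssign ''j'' (IAdd (IVar ''j'') (IConst 1)))"
  have loop: "runs (While ?c ?P) s (1 + (n - i) * (k + 2)) (Inv n)"
    if "i \<le> n" "Inv i s" "nvar s ''j'' = i" "nvar s ''n'' = n" for i s
    using that
  proof (induction "n - i" arbitrary: i s)
    case 0
    then have "runs (While ?c ?P) s 1 (Inv n)" by (intro runs_While_False) simp_all
    then show ?case by (rule runs_steps_mono) simp
  next
    case (Suc m)
    let ?k = "1 + (n - Suc i) * (k + 2)"
    have "i < n" using Suc.hyps(2) by simp
    have "runs ?P s (k + 1) (\<lambda>s'. runs (While ?c ?P) s' ?k (Inv n))"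
    proof (rule runs_Seq, rule runs_mono[OF body[OF \<open>i < n\<close> Suc.prems(2-4)] order_refl])
      fix s' assume "loop_step Inv n i s'"
      then have s': "Inv (Suc i) (set_nvar ''j'' (Suc i) s')"
        "nvar s' ''j'' = i" "nvar s' ''n'' = n"
        by (simp_all add: loop_step_def)
      then have "runs (While ?c ?P) (set_nvar ''j'' (Suc i) s') ?k (Inv n)"
        using Suc.hyps(2) by (intro Suc.hyps(1)) simp_all
      then show "runs (IAssign ''j'' (IAdd (IVar ''j'') (IConst 1))) s' 1
        (\<lambda>s'. runs (While ?c ?P) s' ?k (Inv n))"
        using s' \<open>i < n\<close> fit[of "Suc i"] by (intro runs_IAssign[where v = "Suc i"]) simp_all
    qed
    then have "runs (While ?c ?P) s (Suc (k + 1 + ?k)) (Inv n)"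
      using Suc.prems \<open>i < n\<close> by (intro runs_While_True) simp_all
    moreover have "n - i = Suc (n - Suc i)" using \<open>i < n\<close> by simp
    ultimately show ?case by (elim runs_steps_mono) simp
  qed
  have "runs (For P) s (1 + (1 + n * (k + 2))) (Inv n)"
    using loop[of 0 "set_nvar ''j'' 0 s"] assms(1,2) fit[of 0]
    by (intro runs_Seq runs_IAssign[where v = 0]) simp_all
  then show ?thesis by (rule runs_steps_mono) simp
qed

section \<open>The program\<close>

abbreviation RIf :: "bexp \<Rightarrow> vname \<Rightarrow> iexp \<Rightarrow> rexp \<Rightarrow> rexp \<Rightarrow> com" where
  "RIf c x i d e \<equiv> Cond c (RAssign x i d) (RAssign x i e)"

abbreviation cell :: "vname \<Rightarrow> rexp" where
  "cell x \<equiv> RArr x (IConst 0)"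

abbreviation entry :: "vname \<Rightarrow> vname \<Rightarrow> rexp" where
  "entry x i \<equiv> RArr x (IVar i)"

definition scan_coef_prog :: com where
  "scan_coef_prog =
     Cond (RLess (entry ''a'' ''j'') (RConst 0))
       (RAssign ''need'' (IConst 1) (RSub (RArr ''need'' (IConst 1)) (entry ''a'' ''j'')))
       (RAssign ''need'' (IConst 0) (RAdd (RArr ''need'' (IConst 0)) (entry ''a'' ''j'')))"

definition init_prog :: com where
  "init_prog =
     Seq (RAssign ''need'' (IConst 1) (cell ''theta''))
    (Seq (RAssign ''need'' (IConst 0) (RSub (RConst 1) (cell ''theta'')))
    (For scan_coef_prog))"

definition egain_prog :: com where
  "egain_prog =
     Seq (RIf (RLess (RConst 0) (entry ''a'' ''j'')) ''h'' (IConst 0)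
            (entry ''a'' ''j'') (RSub (RConst 0) (entry ''a'' ''j'')))
    (Seq (RIf (RLess (cell ''h'') (RArr ''need'' (IConst 1))) ''u'' (IConst 0)
            (cell ''h'') (RArr ''need'' (IConst 1)))
    (Seq (RIf (RLess (cell ''h'') (RArr ''need'' (IConst 0))) ''v'' (IConst 0)
            (cell ''h'') (RArr ''need'' (IConst 0)))
    (RIf (RLess (RConst 0) (entry ''a'' ''j'')) ''r'' (IVar ''j'')
       (RAdd (RMul (RSub (RConst 1) (entry ''p'' ''j''))
               (RMul (cell ''v'') (RArr ''need'' (IConst 1))))
             (RMul (entry ''p'' ''j'') (RMul (cell ''u'') (RArr ''need'' (IConst 0)))))
       (RAdd (RMul (RSub (RConst 1) (entry ''p'' ''j''))
               (RMul (cell ''u'') (RArr ''need'' (IConst 0))))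
             (RMul (entry ''p'' ''j'') (RMul (cell ''v'') (RArr ''need'' (IConst 1))))))))"

definition compare_prog :: com where
  "compare_prog =
     Cond (BAnd (RLess (RConst 0) (entry ''r'' ''j''))
            (BNot (BAnd (RLess (RConst 0) (entry ''r'' ''k''))
              (BNot (RLess (RDiv (entry ''c'' ''j'') (entry ''r'' ''j''))
                           (RDiv (entry ''c'' ''k'') (entry ''r'' ''k'')))))))
       (IAssign ''k'' (IVar ''j'')) Skip"

definition reduce_prog :: com where
  "reduce_prog =
     RAssign ''c'' (IVar ''j'') (RSub (entry ''c'' ''j'') (RMul (cell ''y'') (entry ''r'' ''j'')))"

text \<open>
  The entry of \<open>a\<close> is cleared once a variable has been tested, so that its gain becomes \<open>0\<close>. The
  number \<open>h\<close> is \<open>\<plusminus>\<bar>a\<^sub>k\<bar>\<close>, positive iff the answer brings a \<open>1\<close>-certificate closer.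
\<close>

definition observe_prog :: com where
  "observe_prog =
     Seq (RAssign ''h'' (IConst 0)
            (RMul (entry ''a'' ''k'') (RSub (RMul (RConst 2) (entry ''b'' ''k'')) (RConst 1))))
    (Seq (Cond (RLess (RConst 0) (cell ''h''))
            (RAssign ''need'' (IConst 1) (RSub (RArr ''need'' (IConst 1)) (cell ''h'')))
            (RAssign ''need'' (IConst 0) (RAdd (RArr ''need'' (IConst 0)) (cell ''h''))))
    (RAssign ''a'' (IVar ''k'') (RConst 0)))"

definition decide_prog :: com where
  "decide_prog =
     Cond (RLess (RConst 1) (entry ''b'' ''k''))
       (IAssign ''result'' (IAdd (IVar ''k'') (IConst 2)))
       observe_prog"

definition round_prog :: com where
  "round_prog =
     Seq (IAssign ''k'' (IConst 0))
    (Seq (For (Seq egain_prog compare_prog))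
    (Seq (RAssign ''y'' (IConst 0) (RDiv (entry ''c'' ''k'') (entry ''r'' ''k'')))
    (Seq (For reduce_prog)
    decide_prog)))"

definition running :: bexp where
  "running = BAnd (RLess (RConst 0) (RArr ''need'' (IConst 1)))
     (BAnd (RLess (RConst 0) (RArr ''need'' (IConst 0))) (ILess (IVar ''result'') (IConst 1)))"

definition finish_prog :: com where
  "finish_prog =
     Cond (RLess (RConst 0) (RArr ''need'' (IConst 1))) Skip (IAssign ''result'' (IConst 1))"

definition greedy_prog :: com where
  "greedy_prog = Seq init_prog (Seq (While running round_prog) finish_prog)"

text \<open>
  The program is only given the observations \<open>b\<close>, so it replays the greedy run from the start and
  looks up the answers in \<open>b\<close>: it walks down the greedy tree until it reaches an output or an
  unobserved variable. \<open>answer b T\<close> is the resulting decision in the encoding of \<open>result\<close>.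
\<close>

fun answer :: "(nat \<rightharpoonup> bool) \<Rightarrow> strategy \<Rightarrow> nat" where
  "answer b (Output v) = of_bool v"
| "answer b (Test i T0 T1) =
     (case b i of None \<Rightarrow> i + 2 | Some v \<Rightarrow> answer b (if v then T1 else T0))"

fun depth :: "strategy \<Rightarrow> nat" where
  "depth (Output v) = 0"
| "depth (Test i T0 T1) = Suc (max (depth T0) (depth T1))"

lemma depth_le: "evaluates f n b T \<Longrightarrow> depth T \<le> card ({..<n} - dom b)"
proof (induction T arbitrary: b)
  case (Test i T0 T1)
  have less: "card ({..<n} - dom (b(i \<mapsto> v))) < card ({..<n} - dom b)" for v
    using Test.prems by (intro psubset_card_mono) auto
  have T: "evaluates f n (b(i \<mapsto> False)) T0" "evaluates f n (b(i \<mapsto> True)) T1"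
    using Test.prems by simp_all
  have "depth T0 \<le> card ({..<n} - dom (b(i \<mapsto> False)))" by (rule Test.IH(1)[OF T(1)])
  moreover have "depth T1 \<le> card ({..<n} - dom (b(i \<mapsto> True)))" by (rule Test.IH(2)[OF T(2)])
  ultimately show ?case using less[of False] less[of True] by simp
qed simp

definition decides :: "com \<Rightarrow> ltf_instance \<Rightarrow> (nat \<rightharpoonup> bool) \<Rightarrow> nat \<Rightarrow> bool" where
  "decides P I b r \<longleftrightarrow>
     (\<exists>t s. exec unit_weight P (initial_state I b) t s \<and> nvar s ''result'' = r)"

lemma follows_if_decides_answer:
  assumes "evaluates f n b T" "\<And>b'. b \<subseteq>\<^sub>m b' \<Longrightarrow> decides P I b' (answer b' T)"
  shows "follows P I b T"
  using assms
proof (induction T arbitrary: b)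
  case (Output v)
  have "decides P I b (of_bool v)" using Output.prems(2)[OF map_le_refl] by simp
  then show ?case by (auto simp: decides_def intro: follows.Output)
next
  case (Test i T0 T1)
  have T: "b i = None" "evaluates f n (b(i \<mapsto> False)) T0" "evaluates f n (b(i \<mapsto> True)) T1"
    using Test.prems(1) by simp_all
  have subtree: "decides P I b' (answer b' (if v then T1 else T0))" if "b(i \<mapsto> v) \<subseteq>\<^sub>m b'" for v b'
  proof -
    have "b' i = Some v" "b \<subseteq>\<^sub>m b'"
      using that T(1) by (auto simp: map_le_def dom_def split: if_splits)
    then show ?thesis using Test.prems(2)[of b'] by simp
  qed
  have "follows P I (b(i \<mapsto> False)) T0"
    by (rule Test.IH(1)[OF T(2)], drule subtree) simp
  moreover have "follows P I (b(i \<mapsto> True)) T1"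
    by (rule Test.IH(2)[OF T(3)], drule subtree) simp
  moreover have "decides P I b (i + 2)" using Test.prems(2)[OF map_le_refl] T(1) by simp
  ultimately show ?case by (auto simp: decides_def intro: follows.Test)
qed

lemma need_prefix_Suc:
  "need (I\<lparr>dim := Suc i\<rparr>) Map.empty v =
     need (I\<lparr>dim := i\<rparr>) Map.empty v - min (orient v (coef I i)) 0"
  by (simp add: need_def oriented_threshold_def least_term_def)

lemma magnitude_prefix_le: "i \<le> dim I \<Longrightarrow> magnitude (I\<lparr>dim := i\<rparr>) \<le> magnitude I"
  by (simp add: magnitude_def add_mono sum_mono2)

context valid_ltf
begin

lemma egain_eq:
  fixes b i
  defines "a \<equiv> free_coef I b i"
  defines "u \<equiv> min \<bar>a\<bar> (need I b True)" and "v \<equiv> min \<bar>a\<bar> (need I b False)"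
  assumes "undetermined (ltf I) b"
  shows "egain I b i = (if 0 < a
      then (1 - prob I i) * of_int (v * need I b True) + prob I i * of_int (u * need I b False)
      else (1 - prob I i) * of_int (u * need I b False) + prob I i * of_int (v * need I b True))"
proof (cases "a = 0")
  case True
  moreover have "0 \<le> need I b w" for w
    using assms(4) by (simp add: undetermined_ltf_iff less_imp_le)
  ultimately show ?thesis
    by (simp add: expected_gain_def gain_def Let_def a_def u_def v_def min_absorb1)
next
  case False
  then have "favours I i w \<longleftrightarrow> (w \<longleftrightarrow> 0 < a)" for w
    by (auto simp: favours_def a_def free_coef_def split: if_splits)
  then show ?thesis by (simp add: expected_gain_def gain_def Let_def a_def u_def v_def)
qed

end

locale greedy_machine = bounded_machine + valid_ltf +
  assumes fits_magnitude: "\<bar>z\<bar> \<le> magnitude I \<Longrightarrow> fits E (of_int z)"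
    and fits_prob: "i < dim I \<Longrightarrow> fits E (prob I i)"
    and fits_residual: "reachable I b d \<Longrightarrow> i < dim I \<Longrightarrow> fits E (d i)"
    and fits_egain: "undetermined (ltf I) b \<Longrightarrow> i < dim I \<Longrightarrow> fits E (egain I b i)"
    and fits_ratio: "reachable I b d \<Longrightarrow> undetermined (ltf I) b \<Longrightarrow> i < dim I \<Longrightarrow>
      fits E (d i / egain I b i)"
begin

abbreviation "n \<equiv> dim I"

lemma fits_nat: "m \<le> n + 2 \<Longrightarrow> fits E (real m)"
proof -
  assume "m \<le> n + 2"
  moreover have "0 \<le> (\<Sum>i<n. \<bar>coef I i\<bar>)" by (simp add: sum_nonneg)
  ultimately have "\<bar>int m\<bar> \<le> magnitude I" unfolding magnitude_def by linarith
  then show ?thesis using fits_magnitude[of "int m"] by simp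
qed

lemma fits_need: "fits E (of_int (need I b v))"
  by (rule fits_magnitude[OF abs_need_le_magnitude])

definition holds_input :: "(nat \<rightharpoonup> bool) \<Rightarrow> (nat \<Rightarrow> int) \<Rightarrow> (nat \<Rightarrow> real) \<Rightarrow> state \<Rightarrow> bool" where
  "holds_input b a d s \<longleftrightarrow> nvar s ''n'' = n \<and> nvar s ''result'' = 0 \<and>
     (\<forall>i<n. arr s ''a'' i = of_int (a i) \<and> arr s ''c'' i = d i \<and> arr s ''p'' i = prob I i \<and>
       arr s ''b'' i = (case b i of None \<Rightarrow> 2 | Some v \<Rightarrow> of_bool v))"

definition represents :: "(nat \<rightharpoonup> bool) \<Rightarrow> (nat \<rightharpoonup> bool) \<Rightarrow> (nat \<Rightarrow> real) \<Rightarrow> state \<Rightarrow> bool" where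
  "represents b b' d s \<longleftrightarrow> holds_input b (free_coef I b') d s \<and>
     (\<forall>v. arr s ''need'' (of_bool v) = of_int (need I b' v))"

lemma representsD:
  assumes "represents b b' d s"
  shows "nvar s ''n'' = n" "nvar s ''result'' = 0"
    "arr s ''need'' 1 = of_int (need I b' True)" "arr s ''need'' 0 = of_int (need I b' False)"
    "i < n \<Longrightarrow> arr s ''a'' i = of_int (free_coef I b' i)" "i < n \<Longrightarrow> arr s ''c'' i = d i"
    "i < n \<Longrightarrow> arr s ''p'' i = prob I i"
    "i < n \<Longrightarrow> arr s ''b'' i = (case b i of None \<Rightarrow> 2 | Some v \<Rightarrow> of_bool v)"
  using assms by (simp_all add: represents_def holds_input_def all_bool_eq)

lemma fits_state_initial: "fits_state (initial_state I b)"
  unfolding fits_state_def initial_state_def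
  using fits_nat[of 0] fits_nat[of 1] fits_nat[of 2] fits_nat[of n] fits_prob
    fits_residual[OF reachable.start] fits_magnitude abs_coef_le_magnitude[of _ I]
  by (auto simp: magnitude_def sum_nonneg split: option.split)

abbreviation prefix_need :: "nat \<Rightarrow> bool \<Rightarrow> int" where
  "prefix_need i \<equiv> need (I\<lparr>dim := i\<rparr>) Map.empty"

definition coefs_scanned :: "(nat \<rightharpoonup> bool) \<Rightarrow> nat \<Rightarrow> state \<Rightarrow> bool" where
  "coefs_scanned b i s \<longleftrightarrow> holds_input b (coef I) (cost I) s \<and>
     (\<forall>v. arr s ''need'' (of_bool v) = of_int (prefix_need i v))"

lemma fits_prefix_need: "i \<le> n \<Longrightarrow> fits E (of_int (prefix_need i v))"
  by (rule fits_magnitude, rule order_trans[OF abs_need_le_magnitude magnitude_prefix_le])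

lemma runs_scan_coef:
  assumes "i < n" "coefs_scanned b i s" "nvar s ''j'' = i" "nvar s ''n'' = n"
  shows "runs scan_coef_prog s 2 (loop_step (coefs_scanned b) n i)"
    (is "runs _ _ _ ?Q")
  unfolding scan_coef_prog_def
proof (rule runs_Cond_RAssign[where l = "of_bool (coef I i < 0)"])
  let ?v = "of_int (prefix_need (Suc i) (coef I i < 0))"
  have s: "arr s ''a'' i = of_int (coef I i)" "arr s ''need'' 1 = of_int (prefix_need i True)"
    "arr s ''need'' 0 = of_int (prefix_need i False)"
    using assms by (auto simp: coefs_scanned_def holds_input_def all_bool_eq)
  show "?Q (set_arr ''need'' (of_bool (coef I i < 0)) ?v s)"
    using assms
    by (auto simp: loop_step_def coefs_scanned_def holds_input_def need_prefix_Suc orient_def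
        all_bool_eq)
  show "(if bval (RLess (entry ''a'' ''j'') (RConst 0)) s
      then rval (RSub (RArr ''need'' (IConst 1)) (entry ''a'' ''j'')) s
      else rval (RAdd (RArr ''need'' (IConst 0)) (entry ''a'' ''j'')) s) = ?v"
    using s assms(3) by (simp add: need_prefix_Suc orient_def del: One_nat_def)
qed (use assms fits_prefix_need[of "Suc i"] in \<open>auto simp: coefs_scanned_def holds_input_def\<close>)

lemma runs_init:
  "runs init_prog (initial_state I b) (4 + 4 * n) (represents b Map.empty (cost I))"
proof -
  have start: "prefix_need 0 True = threshold I" "prefix_need 0 False = 1 - threshold I"
    by (simp_all add: need_def oriented_threshold_def)
  let ?s = "set_arr ''need'' 0 (of_int (prefix_need 0 False))
    (set_arr ''need'' 1 (of_int (prefix_need 0 True)) (initial_state I b))"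
  have "coefs_scanned b 0 (set_nvar ''j'' 0 ?s)"
    by (auto simp: coefs_scanned_def holds_input_def initial_state_def all_bool_eq)
  then have loop: "runs (For scan_coef_prog) ?s (2 + n * (2 + 2)) (coefs_scanned b n)"
    by (rule runs_For[OF _ _ _ runs_scan_coef]) (auto simp: initial_state_def fits_nat)
  have "runs init_prog (initial_state I b) (1 + (1 + (2 + n * (2 + 2)))) (coefs_scanned b n)"
    unfolding init_prog_def
    by (rule runs_Seq, rule runs_RAssign[where i = 1 and v = "of_int (prefix_need 0 True)"],
        rule runs_Seq, rule runs_RAssign[where i = 0 and v = "of_int (prefix_need 0 False)"],
        rule loop)
       (use fits_prefix_need[of 0 True] fits_prefix_need[of 0 False] in
         \<open>simp_all add: initial_state_def start del: One_nat_def\<close>)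
  then show ?thesis
    by (rule runs_mono) (simp_all add: coefs_scanned_def represents_def free_coef_def[abs_def])
qed

lemma runs_egain:
  assumes "undetermined (ltf I) b'" "i < n" "represents b b' d s" "nvar s ''j'' = i"
  shows "runs egain_prog s 8
    (\<lambda>s'. represents b b' d s' \<and> nvar s' = nvar s \<and>
      arr s' ''r'' = (arr s ''r'')(i := egain I b' i))"
    (is "runs _ _ _ ?Q")
proof -
  define h where "h = \<bar>free_coef I b' i\<bar>"
  define u where "u = min h (need I b' True)"
  define v where "v = min h (need I b' False)"
  have need: "0 < need I b' x" for x using assms(1) by (simp add: undetermined_ltf_iff)
  have "0 \<le> h" "h \<le> magnitude I"
    unfolding h_def free_coef_def using abs_coef_le_magnitude[OF assms(2)] by auto
  then have fits: "fits E (of_int h)" "fits E (of_int u)" "fits E (of_int v)"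
    using need[of True] need[of False] by (auto intro!: fits_magnitude simp: u_def v_def)
  let ?s = "set_arr ''r'' i (egain I b' i)
    (set_arr ''v'' 0 (of_int v) (set_arr ''u'' 0 (of_int u) (set_arr ''h'' 0 (of_int h) s)))"
  have post: "?Q ?s" using assms(3) by (auto simp: represents_def holds_input_def)
  have "runs egain_prog s (2 + (2 + (2 + 2))) ?Q"
    unfolding egain_prog_def
    by (rule runs_Seq, rule runs_Cond_RAssign[where l = 0 and v = "of_int h"],
        rule runs_Seq, rule runs_Cond_RAssign[where l = 0 and v = "of_int u"],
        rule runs_Seq, rule runs_Cond_RAssign[where l = 0 and v = "of_int v"],
        rule runs_Cond_RAssign[where l = i and v = "egain I b' i"], rule post)
       (use fits fits_egain[OF assms(1,2)] assms(2,4) in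
         \<open>simp_all add: representsD[OF assms(3)] egain_eq[OF assms(1)] u_def v_def h_def
           del: One_nat_def\<close>)
  then show ?thesis by simp
qed

abbreviation scanned :: "(nat \<rightharpoonup> bool) \<Rightarrow> (nat \<Rightarrow> real) \<Rightarrow> nat \<Rightarrow> nat" where
  "scanned b d \<equiv> argmin_scan (\<lambda>i. 0 < egain I b i) (\<lambda>i. d i / egain I b i)"

lemma runs_compare:
  assumes "i < n" "represents b b' d s" "nvar s ''j'' = i" "nvar s ''k'' = scanned b' d i"
    "\<And>l. l \<le> i \<Longrightarrow> arr s ''r'' l = egain I b' l"
    and post: "Q (set_nvar ''k'' (scanned b' d (Suc i)) s)"
  shows "runs compare_prog s 2 Q"
proof -
  let ?k = "scanned b' d i"
  let ?better = "BAnd (RLess (RConst 0) (entry ''r'' ''j''))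
      (BNot (BAnd (RLess (RConst 0) (entry ''r'' ''k''))
        (BNot (RLess (RDiv (entry ''c'' ''j'') (entry ''r'' ''j''))
                     (RDiv (entry ''c'' ''k'') (entry ''r'' ''k''))))))"
  have k: "?k \<le> i" using argmin_scan_le[of _ _ i] by (rule order_trans) simp
  then have better: "bval ?better s \<longleftrightarrow>
      0 < egain I b' i \<and> (\<not> 0 < egain I b' ?k \<or> d i / egain I b' i < d ?k / egain I b' ?k)"
    using assms(1,3-5) by (simp add: representsD(6)[OF assms(2)])
  have "runs compare_prog s (Suc 1) Q"
    unfolding compare_prog_def
  proof (rule runs_Cond)
    assume "bval ?better s"
    then have "scanned b' d (Suc i) = i" unfolding better by (simp add: Let_def)
    then show "runs (IAssign ''k'' (IVar ''j'')) s 1 Q"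
      using post assms(1,3) fits_nat[of i] by (intro runs_IAssign[where v = i]) simp_all
  next
    assume "\<not> bval ?better s"
    then have "scanned b' d (Suc i) = nvar s ''k''"
      unfolding better assms(4) by (auto simp: Let_def)
    moreover have "set_nvar ''k'' (nvar s ''k'') s = s" by (simp add: set_nvar_def)
    ultimately show "runs Skip s 1 Q" using post by (intro runs_Skip) simp
  qed simp
  then show ?thesis by (simp add: numeral_2_eq_2)
qed

definition gains_scanned :: "(nat \<rightharpoonup> bool) \<Rightarrow> (nat \<rightharpoonup> bool) \<Rightarrow> (nat \<Rightarrow> real) \<Rightarrow> nat \<Rightarrow> state \<Rightarrow> bool" where
  "gains_scanned b b' d i s \<longleftrightarrow> represents b b' d s \<and>
     (\<forall>l<i. arr s ''r'' l = egain I b' l) \<and> nvar s ''k'' = scanned b' d i"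

lemma runs_gain_loop:
  assumes "undetermined (ltf I) b'" "represents b b' d s" "nvar s ''k'' = 0"
  shows "runs (For (Seq egain_prog compare_prog)) s (2 + n * 12) (gains_scanned b b' d n)"
proof -
  have body: "runs (Seq egain_prog compare_prog) s (8 + 2) (loop_step (gains_scanned b b' d) n i)"
    if i: "i < n" and s: "gains_scanned b b' d i s" "nvar s ''j'' = i" "nvar s ''n'' = n" for i s
  proof (rule runs_Seq, rule runs_mono[OF runs_egain[OF assms(1) i]])
    fix s' assume s': "represents b b' d s' \<and> nvar s' = nvar s \<and>
      arr s' ''r'' = (arr s ''r'')(i := egain I b' i)"
    moreover have "arr s' ''r'' l = egain I b' l" if "l \<le> i" for l
      using that s(1) s' by (auto simp: gains_scanned_def)
    ultimately show "runs compare_prog s' 2 (loop_step (gains_scanned b b' d) n i)"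
      using i s by (intro runs_compare)
        (auto simp: loop_step_def gains_scanned_def represents_def holds_input_def
          simp del: argmin_scan.simps)
  qed (use s in \<open>simp_all add: gains_scanned_def\<close>)
  have "gains_scanned b b' d 0 (set_nvar ''j'' 0 s)" "nvar s ''n'' = n"
    using assms(2,3) by (auto simp: gains_scanned_def represents_def holds_input_def)
  then have "runs (For (Seq egain_prog compare_prog)) s (2 + n * (8 + 2 + 2))
      (gains_scanned b b' d n)"
    by (rule runs_For[OF _ _ _ body]) (simp add: fits_nat)
  then show ?thesis by simp
qed

lemma runs_reduce_loop:
  assumes "reachable I b' d" "undetermined (ltf I) b'" "gains_scanned b b' d n s"
    "arr s ''y'' 0 = d (pick I b' d) / egain I b' (pick I b' d)"
  shows "runs (For reduce_prog) s (2 + n * 3)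
    (\<lambda>s'. represents b b' (residual I b' d) s' \<and> nvar s' ''k'' = pick I b' d)"
proof -
  let ?k = "pick I b' d" and ?d = "\<lambda>i l. if l < i then residual I b' d l else d l"
  define Inv where "Inv i s \<longleftrightarrow> represents b b' (?d i) s \<and> (\<forall>l<n. arr s ''r'' l = egain I b' l) \<and>
    nvar s ''k'' = ?k \<and> arr s ''y'' 0 = d ?k / egain I b' ?k" for i and s :: state
  have body: "runs reduce_prog s 1 (loop_step Inv n i)"
    if i: "i < n" and s: "Inv i s" "nvar s ''j'' = i" "nvar s ''n'' = n" for i s
    unfolding reduce_prog_def
  proof (rule runs_RAssign[where i = i and v = "residual I b' d i"])
    show "fits E (residual I b' d i)" by (rule fits_residual[OF reachable.step[OF assms(1,2)] i])
    have "represents b b' (?d i) s" using s(1) by (simp add: Inv_def)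
    from representsD(6)[OF this i]
    show "rval (RSub (entry ''c'' ''j'') (RMul (cell ''y'') (entry ''r'' ''j''))) s =
        residual I b' d i"
      using s i by (simp add: Inv_def reduced_cost_def)
  qed (use s in \<open>auto simp: loop_step_def Inv_def represents_def holds_input_def less_Suc_eq\<close>)
  have "Inv 0 (set_nvar ''j'' 0 s)" "nvar s ''n'' = n"
    using assms(3,4)
    by (auto simp: Inv_def gains_scanned_def represents_def holds_input_def cheapest_def)
  then have "runs (For reduce_prog) s (2 + n * (1 + 2)) (Inv n)"
    by (rule runs_For[OF _ _ _ body]) (simp add: fits_nat)
  then show ?thesis by (rule runs_mono) (simp_all add: Inv_def represents_def holds_input_def)
qed

lemma runs_observe:
  assumes s: "represents b b' d s" "nvar s ''k'' = k"
    and k: "k < n" "b' k = None" "coef I k \<noteq> 0" "b k = Some v"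
  shows "runs observe_prog s 4 (represents b (b'(k \<mapsto> v)) d)"
proof -
  let ?b = "b'(k \<mapsto> v)" and ?t = "orient v (coef I k)" and ?u = "favours I k v"
  let ?s = "set_arr ''a'' k 0
      (set_arr ''need'' (of_bool ?u) (of_int (need I ?b ?u)) (set_arr ''h'' 0 (of_int ?t) s))"
  note need = need_upd[where b = b', OF k(1,2)]
  have t: "0 < ?t \<longleftrightarrow> ?u" "\<bar>coef I k\<bar> = (if ?u then ?t else - ?t)"
    using k(3) by (auto simp: orient_def favours_def)
  have fits: "fits E (of_int ?t)"
    using abs_coef_le_magnitude[OF k(1)] by (intro fits_magnitude) (simp add: orient_def)
  have answer: "real_of_int (coef I k) * (2 * of_bool v - 1) = of_int ?t" by (simp add: orient_def)
  have post: "represents b ?b d ?s"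
    using s(1) by (auto simp: represents_def holds_input_def free_coef_def need all_bool_eq)
  have "runs observe_prog s (1 + (2 + 1)) (represents b ?b d)"
    unfolding observe_prog_def
    by (rule runs_Seq, rule runs_RAssign[where i = 0 and v = "of_int ?t"],
        rule runs_Seq,
        rule runs_Cond_RAssign[where l = "of_bool ?u" and v = "of_int (need I ?b ?u)"],
        rule runs_RAssign[where i = k and v = 0], rule post)
       (use s(2) k fits fits_nat[of 0] fits_need[of ?b ?u] t answer in
         \<open>simp_all add: representsD[OF s(1)] need free_coef_def del: One_nat_def\<close>)
  then show ?thesis by simp
qed

definition round_result :: "(nat \<rightharpoonup> bool) \<Rightarrow> (nat \<rightharpoonup> bool) \<Rightarrow> (nat \<Rightarrow> real) \<Rightarrow> nat \<Rightarrow> state \<Rightarrow> bool" where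
  "round_result b b' d k s \<longleftrightarrow> (case b k of
       None \<Rightarrow> nvar s ''result'' = k + 2 \<and> 0 < arr s ''need'' 1
     | Some v \<Rightarrow> represents b (b'(k \<mapsto> v)) d s)"

lemma runs_decide:
  assumes "undetermined (ltf I) b'" "represents b b' d s" "nvar s ''k'' = k"
    and k: "k < n" "b' k = None" "coef I k \<noteq> 0"
  shows "runs decide_prog s 5 (round_result b b' d k)"
proof -
  note input = representsD(8)[OF assms(2) k(1)]
  have "runs decide_prog s (Suc 4) (round_result b b' d k)"
    unfolding decide_prog_def
  proof (rule runs_Cond)
    assume unknown: "bval (RLess (RConst 1) (entry ''b'' ''k'')) s"
    show "runs (IAssign ''result'' (IAdd (IVar ''k'') (IConst 2))) s 4 (round_result b b' d k)"
    proof (rule runs_steps_mono, rule runs_IAssign[where v = "k + 2"])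
      have "b k = None"
        using unknown input assms(3) by (cases "b k") (auto simp: of_bool_def split: if_splits)
      then show "round_result b b' d k (set_nvar ''result'' (k + 2) s)"
        using representsD(3)[OF assms(2)] assms(1)
        by (simp add: round_result_def undetermined_ltf_iff)
    qed (use assms(3) fits_nat[of "k + 2"] k(1) in simp_all)
  next
    assume known: "\<not> bval (RLess (RConst 1) (entry ''b'' ''k'')) s"
    obtain v where v: "b k = Some v" using known input assms(3) by (cases "b k") auto
    show "runs observe_prog s 4 (round_result b b' d k)"
      by (rule runs_mono[OF runs_observe[OF assms(2,3) k v]]) (simp_all add: round_result_def v)
  qed simp
  then show ?thesis by simp
qed

lemma runs_round:
  assumes reach: "reachable I b' d" and und: "undetermined (ltf I) b'" and s: "represents b b' d s"
  defines "k \<equiv> pick I b' d"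
  shows "runs round_prog s (11 + n * 15) (round_result b b' (residual I b' d) k)"
    (is "runs _ _ _ ?Q")
proof -
  have k: "k < n" "0 < egain I b' k" "b' k = None"
    unfolding k_def by (simp_all add: cheapest_less cheapest_charge_pos cheapest_None und)
  then have "coef I k \<noteq> 0" using egain_pos_iff[OF und] by (simp add: free_coef_def)
  with k have decide: "runs decide_prog s 5 ?Q"
    if "represents b b' (residual I b' d) s" "nvar s ''k'' = k" for s
    using runs_decide[OF und that] by simp
  let ?ratio = "RAssign ''y'' (IConst 0) (RDiv (entry ''c'' ''k'') (entry ''r'' ''k''))"
  have ratio: "runs (Seq ?ratio (Seq (For reduce_prog) decide_prog)) s (1 + ((2 + n * 3) + 5)) ?Q"
    if s: "gains_scanned b b' d n s" for s
  proof (rule runs_Seq, rule runs_RAssign[where i = 0 and v = "d k / egain I b' k"], rule runs_Seq)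
    let ?s = "set_arr ''y'' 0 (d k / egain I b' k) s"
    have "gains_scanned b b' d n ?s"
      using s by (simp add: gains_scanned_def represents_def holds_input_def)
    from runs_reduce_loop[OF reach und this, folded k_def]
    show "runs (For reduce_prog) ?s (2 + n * 3) (\<lambda>s'. runs decide_prog s' 5 ?Q)"
      by (rule runs_mono[OF _ order_refl]) (simp_all add: decide)
    have "represents b b' d s" "nvar s ''k'' = k" "arr s ''r'' k = egain I b' k"
      using s k(1) by (simp_all add: gains_scanned_def) (simp add: k_def cheapest_def)
    then show "rval (RDiv (entry ''c'' ''k'') (entry ''r'' ''k'')) s = d k / egain I b' k"
      using representsD(6)[OF _ k(1)] by simp
  qed (simp_all add: fits_ratio[OF reach und k(1)])
  have "represents b b' d (set_nvar ''k'' 0 s)"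
    using s by (simp add: represents_def holds_input_def)
  then have "runs (Seq (For (Seq egain_prog compare_prog))
        (Seq ?ratio (Seq (For reduce_prog) decide_prog)))
      (set_nvar ''k'' 0 s) ((2 + n * 12) + (1 + ((2 + n * 3) + 5))) ?Q"
    by (intro runs_Seq[OF runs_mono[OF runs_gain_loop[OF und] order_refl ratio]]) simp_all
  then have "runs round_prog s (1 + ((2 + n * 12) + (1 + ((2 + n * 3) + 5)))) ?Q"
    unfolding round_prog_def
    by (intro runs_Seq, elim runs_IAssign) (simp_all add: fits_nat[of 0, simplified])
  then show ?thesis by (rule runs_steps_mono) simp
qed

lemma bval_running:
  "represents b b' d s \<Longrightarrow> bval running s \<longleftrightarrow> undetermined (ltf I) b'"
  by (auto simp: running_def representsD undetermined_ltf_iff all_bool_eq simp del: One_nat_def)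

definition loop_result :: "(nat \<rightharpoonup> bool) \<Rightarrow> strategy \<Rightarrow> state \<Rightarrow> bool" where
  "loop_result b T s \<longleftrightarrow>
     (if 0 < arr s ''need'' 1 then nvar s ''result'' = answer b T else answer b T = 1)"

lemma loop_result_Output:
  assumes "certificate (ltf I) b' v" "represents b b' d s"
  shows "loop_result b (Output v) s"
proof -
  have "need I b' v \<le> 0" using assms(1) by (simp add: need_le_0_iff)
  moreover have "0 < need I b' False + need I b' True"
    by (simp add: sum_need add_pos_nonneg sum_nonneg)
  ultimately show ?thesis
    using representsD(2,3)[OF assms(2)] by (cases v) (auto simp: loop_result_def)
qed

lemma runs_loop:
  assumes "greedy (ltf I) n (egain I) b' d T" "reachable I b' d" "represents b b' d s"
  shows "runs (While running round_prog) s (1 + depth T * (12 + n * 15)) (loop_result b T)"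
  using assms
proof (induction arbitrary: s)
  case (Output b' v d)
  then have "\<not> bval running s" using bval_running by (auto simp: undetermined_def)
  then show ?case
    using loop_result_Output Output
    by (intro runs_steps_mono[OF runs_While_False]) (auto simp: running_def)
next
  case (Test b' k d T0 T1)
  let ?loop = "While running round_prog" and ?d = "residual I b' d"
  let ?K = "1 + max (depth T0) (depth T1) * (12 + n * 15)" and ?Q = "loop_result b (Test k T0 T1)"
  have reach: "reachable I (b'(k \<mapsto> v)) ?d" for v
    unfolding Test.hyps(2) by (rule reachable.step[OF Test.prems(1) Test.hyps(1)])
  have continue: "runs ?loop s' ?K ?Q" if s': "round_result b b' ?d k s'" for s'
  proof (cases "b k")
    case None
    with s' have "runs ?loop s' 1 ?Q"
      by (intro runs_While_False) (simp_all add: running_def round_result_def loop_result_def)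
    then show ?thesis by (rule runs_steps_mono) simp
  next
    case (Some v)
    with s' have rep: "represents b (b'(k \<mapsto> v)) ?d s'" by (simp add: round_result_def)
    have "runs ?loop s' (1 + depth (if v then T1 else T0) * (12 + n * 15))
        (loop_result b (if v then T1 else T0))"
      using Test.IH(1)[OF reach, of s'] Test.IH(2)[OF reach, of s'] rep
      by (cases v) (simp_all del: fun_upd_apply)
    then show ?thesis
      using Some by (elim runs_mono) (auto simp: loop_result_def intro!: mult_le_mono1)
  qed
  have "runs round_prog s (11 + n * 15) (\<lambda>s'. runs ?loop s' ?K ?Q)"
    using runs_round[OF Test.prems(1) Test.hyps(1) Test.prems(2)] continue
    unfolding Test.hyps(2)[symmetric] by (rule runs_mono[OF _ order_refl])
  then have "runs ?loop s (Suc (11 + n * 15 + ?K)) ?Q"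
    using bval_running[OF Test.prems(2)] Test.hyps(1)
    by (intro runs_While_True) (simp_all add: running_def)
  then show ?case by (rule runs_steps_mono) simp
qed

lemma greedy_prog_exec:
  assumes "greedy (ltf I) n (egain I) Map.empty (cost I) T"
  shows "\<exists>t s. exec w greedy_prog (initial_state I b) t s \<and> t \<le> 40000 * E * (n + 1) ^ 2 \<and>
    nvar s ''result'' = answer b T"
proof -
  let ?k = "depth T * (12 + n * 15)" and ?Q = "\<lambda>s. nvar s ''result'' = answer b T"
  have finish: "runs finish_prog s (Suc 1) ?Q" if "loop_result b T s" for s
    unfolding finish_prog_def using that fits_nat[of 1]
    by (intro runs_Cond runs_Skip runs_IAssign[where v = 1])
      (simp_all add: loop_result_def split: if_splits)
  have loop: "runs (Seq (While running round_prog) finish_prog) s ((1 + ?k) + Suc 1) ?Q"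
    if "represents b Map.empty (cost I) s" for s
    using runs_loop[OF assms reachable.start that]
    by (intro runs_Seq) (rule runs_mono[OF _ order_refl finish])
  have "runs greedy_prog (initial_state I b) ((4 + 4 * n) + ((1 + ?k) + Suc 1)) ?Q"
    unfolding greedy_prog_def by (rule runs_Seq, rule runs_mono[OF runs_init order_refl loop])
  moreover have "depth T \<le> n" using depth_le[OF greedy_evaluates[OF assms]] by simp
  then have "?k \<le> n * (12 + n * 15)" by (rule mult_le_mono1)
  then have "(4 + 4 * n) + ((1 + ?k) + Suc 1) \<le> 16 * (n + 1) ^ 2"
    by (simp add: power2_eq_square algebra_simps)
  ultimately have "runs greedy_prog (initial_state I b) (16 * (n + 1) ^ 2) ?Q"
    by (rule runs_steps_mono)
  then show ?thesis
    using fits_state_initial[of b] unfolding runs_def step_time_def by (auto simp: mult_ac)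
qed

end

section \<open>Polynomial time\<close>

lemma greedy_machine_unit: "valid_instance I \<Longrightarrow> 0 < E \<Longrightarrow> greedy_machine unit_weight (\<lambda>_ _. True) E I"
  by unfold_locales (simp_all add: unit_weight_def)

lemma greedy_machine_bit:
  assumes "valid_instance I" "rational_instance I"
  shows "greedy_machine bit_weight fits_bits (8 * (instance_size bit_weight I + 1) ^ 2) I"
proof -
  interpret rational_ltf I by unfold_locales (use assms in auto)
  let ?E = "8 * (bits + 1) ^ 2"
  have E: "8 * (Suc bits) ^ 2 = 8 * bits * bits + 16 * bits + 8"
    by (simp add: power2_eq_square algebra_simps)
  show ?thesis
  proof unfold_locales
    show "fits_bits ?E (of_int z)" if "\<bar>z\<bar> \<le> magnitude I" for z
      by (rule fits_bits_mono[OF fits_bits_of_int[OF order_trans[OF that magnitude_le]]])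
        (simp add: E)
    show "fits_bits ?E (prob I i)" if "i < dim I" for i
      by (rule fits_bits_mono[OF fits_prob[OF that]]) (simp add: E)
    show "fits_bits ?E (d i)" if "reachable I b d" "i < dim I" for b d i
      by (rule fits_bits_mono[OF fits_reachable[OF that]]) (simp add: E)
    show "fits_bits ?E (egain I b i)" if "undetermined (ltf I) b" "i < dim I" for b i
      by (rule fits_bits_mono[OF fits_egain[OF that]]) (simp add: E)
    show "fits_bits ?E (d i / egain I b i)"
      if "reachable I b d" "undetermined (ltf I) b" "i < dim I" for b d i
      using fits_bits_divide[OF fits_reachable[OF that(1,3)] fits_egain[OF that(2,3)]]
      by (rule fits_bits_mono) (simp add: E)
  qed (rule fits_bits_mono fits_bits_of_int fits_bits_add fits_bits_diff fits_bits_mult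
      fits_bits_divide fits_bits_imp_bit_weight_le; assumption | simp add: E)+
qed

lemma poly_time_greedy_prog:
  assumes "\<And>I. I \<in> A \<Longrightarrow> greedy_machine w fits (8 * (instance_size w I + 1) ^ 2) I"
  shows "poly_time w A greedy_prog"
  unfolding poly_time_def
proof (intro exI[of _ "smult 320000 ([:1, 1:] ^ 4)"] ballI allI impI)
  fix I b assume "I \<in> A"
  then interpret greedy_machine w fits "8 * (instance_size w I + 1) ^ 2" I by (rule assms)
  let ?L = "instance_size w I"
  obtain T where "greedy (ltf I) n (egain I) Map.empty (cost I) T" using ex_greedy by blast
  then obtain t s where run: "exec w greedy_prog (initial_state I b) t s"
    "t \<le> 40000 * (8 * (?L + 1) ^ 2) * (n + 1) ^ 2"
    using greedy_prog_exec by blast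
  note run(2)
  also have "\<dots> \<le> 40000 * (8 * (?L + 1) ^ 2) * (?L + 1) ^ 2"
    using dim_le_instance_size[of I w] by (intro mult_le_mono2 power_mono) auto
  also have "\<dots> = poly (smult 320000 ([:1, 1:] ^ 4)) ?L"
    by (simp flip: power_add add: add.commute)
  finally show "\<exists>t s. exec w greedy_prog (initial_state I b) t s \<and>
      t \<le> poly (smult 320000 ([:1, 1:] ^ 4)) ?L"
    using run(1) by blast
qed

lemma greedy_prog_follows:
  assumes "valid_instance I" "greedy (ltf I) (dim I) (egain I) Map.empty (cost I) T"
  shows "follows greedy_prog I Map.empty T"
proof -
  interpret greedy_machine unit_weight "\<lambda>_ _. True" 1 I
    using assms(1) by (intro greedy_machine_unit) simp_all
  have "decides greedy_prog I b (answer b T)" for b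
    using greedy_prog_exec[OF assms(2)] unfolding decides_def by blast
  then show ?thesis by (intro follows_if_decides_answer[OF greedy_evaluates[OF assms(2)]])
qed

theorem theorem5:
  "\<exists>P. poly_time bit_weight {I. valid_instance I \<and> rational_instance I} P \<and>
       poly_time unit_weight {I. valid_instance I} P \<and>
       (\<forall>I. valid_instance I \<longrightarrow>
          (\<exists>T\<in>strategies I. follows P I Map.empty T \<and> expected_cost I T \<le> 3 * opt_cost I))"
proof (intro exI[of _ greedy_prog] conjI allI impI)
  show "poly_time bit_weight {I. valid_instance I \<and> rational_instance I} greedy_prog"
    by (rule poly_time_greedy_prog, rule greedy_machine_bit) simp_all
  show "poly_time unit_weight {I. valid_instance I} greedy_prog"
    by (rule poly_time_greedy_prog, rule greedy_machine_unit) simp_all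
  fix I assume I: "valid_instance I"
  then interpret valid_ltf I by unfold_locales
  obtain T where T: "greedy (ltf I) (dim I) (egain I) Map.empty (cost I) T" using ex_greedy by blast
  show "\<exists>T\<in>strategies I. follows greedy_prog I Map.empty T \<and> expected_cost I T \<le> 3 * opt_cost I"
    using greedy_expected_cost_le[OF T] greedy_prog_follows[OF I T] by blast
qed

end
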